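(* Let $\alpha_2=4\pi$. For every $\alpha\ge\alpha_2$ there exists a sequence $\{u_k\}\subset\mathcal{H}_2^{1,1}(\mathbb{R}^2_+)$ with $|\nabla_{\mathbb{B}}u_k|_2=1$ for all $k$ such that $$\frac{1}{|u_k|_2^2}\int_{\mathbb{R}^2_+}\left(e^{\alpha\frac{|u_k(x)|^2}{|\nabla_{\mathbb{B}}u_k|_2^2}}-1\right)\frac{dx_1}{x_1}dx_2\ \ge\ \frac{1}{|u_k|_2^2}\int_{\mathbb{R}^2_+}\left(e^{\alpha_2\frac{|u_k(x)|^2}{|\nabla_{\mathbb{B}}u_k|_2^2}}-1\right)\frac{dx_1}{x_1}dx_2\ \longrightarrow\ \infty$$ as $k\to\infty$.
   Context: $\mathbb{R}^2_+=\{(x_1,x_2): x_1>0,\ x_2\in\mathbb{R}\}$, equipped with the measure $\frac{dx_1}{x_1}dx_2$. The gradient is $\nabla_{\mathbb{B}}=(x_1\partial_{x_1},\partial_{x_2})$, and $|\cdot|_2$ is the $L^2$ norm over $\mathbb{R}^2_+$ with respect to $\frac{dx_1}{x_1}dx_2$: $|u|_2^2=\int_{\mathbb{R}^2_+}|u|^2\frac{dx_1}{x_1}dx_2$ and $|\nabla_{\mathbb{B}}u|_2^2=\int_{\mathbb{R}^2_+}\left(|x_1\partial_{x_1}u|^2+|\partial_{x_2}u|^2\right)\frac{dx_1}{x_1}dx_2$. The cone Sobolev space $\mathcal{H}_2^{1,1}(\mathbb{R}^2_+)$ is the space of distributions $u$ on $\mathbb{R}^2_+$ such that $u$, $x_1\partial_{x_1}u$,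 $\partial_{x_2}u$ are square integrable with respect to $\frac{dx_1}{x_1}dx_2$. *)

theory Defs
  imports "HOL-Analysis.Analysis"
begin

fun Ck :: "nat \<Rightarrow> ('a::euclidean_space \<Rightarrow> real) \<Rightarrow> bool" where
  "Ck 0 f \<longleftrightarrow> continuous_on UNIV f"
| "Ck (Suc n) f \<longleftrightarrow> (\<forall>x. f differentiable (at x)) \<and>
     (\<forall>v. Ck n (\<lambda>x. frechet_derivative f (at x) v))"

definition test_functions :: "'a::euclidean_space set \<Rightarrow> ('a \<Rightarrow> real) set" where
  "test_functions \<Omega> = {\<phi>. (\<forall>n. Ck n \<phi>) \<and>
     compact (closure {x. \<phi> x \<noteq> 0}) \<and> closure {x. \<phi> x \<noteq> 0} \<subseteq> \<Omega>}"

definition locally_integrable_on :: "'a::euclidean_space set \<Rightarrow> ('a \<Rightarrow> real) \<Rightarrow> bool" where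
  "locally_integrable_on \<Omega> f \<longleftrightarrow> (\<forall>K. compact K \<and> K \<subseteq> \<Omega> \<longrightarrow> set_integrable lborel K f)"

text \<open>The distribution defined by \<open>u\<close> on the open set \<open>\<Omega>\<close> has as its derivative in direction
  \<open>v\<close> the distribution defined by the locally integrable function \<open>g\<close>. The pairing is with respect
  to Lebesgue measure, not the weighted measure below.\<close>

definition has_weak_deriv ::
    "'a::euclidean_space set \<Rightarrow> ('a \<Rightarrow> real) \<Rightarrow> 'a \<Rightarrow> ('a \<Rightarrow> real) \<Rightarrow> bool" where
  "has_weak_deriv \<Omega> u v g \<longleftrightarrow> locally_integrable_on \<Omega> u \<and> locally_integrable_on \<Omega> g \<and>
     (\<forall>\<phi> \<in> test_functions \<Omega>.
        (LINT x:\<Omega>|lborel. u x * frechet_derivative \<phi> (at x) v) = - (LINT x:\<Omega>|lborel. g x * \<phi> x))"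

text \<open>Weak derivatives are determined only almost everywhere; the choice of representative does not
  affect any integral formed from it.\<close>

definition weak_deriv :: "'a::euclidean_space set \<Rightarrow> ('a \<Rightarrow> real) \<Rightarrow> 'a \<Rightarrow> 'a \<Rightarrow> real" where
  "weak_deriv \<Omega> u v = (SOME g. has_weak_deriv \<Omega> u v g)"

definition half_plane :: "(real \<times> real) set" where
  "half_plane = {x. fst x > 0}"

definition cone_measure :: "(real \<times> real) measure" where
  "cone_measure = density (restrict_space lborel half_plane) (\<lambda>x. ennreal (1 / fst x))"

definition cone_L2_norm :: "(real \<times> real \<Rightarrow> 'b::real_normed_vector) \<Rightarrow> real" where
  "cone_L2_norm f = sqrt (\<integral>x. (norm (f x))\<^sup>2 \<partial>cone_measure)"

text \<open>The elements are Borel representatives of the classes modulo null sets; their values outside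
  the half plane are irrelevant. The distribution \<open>x\<^sub>1 \<partial>\<^sub>1 u\<close> is a function precisely when
  \<open>\<partial>\<^sub>1 u\<close> is, because \<open>x\<^sub>1\<close> is smooth and nowhere zero on the half plane.\<close>

definition cone_sobolev :: "(real \<times> real \<Rightarrow> real) set" where
  "cone_sobolev = {u. u \<in> borel_measurable cone_measure \<and>
     integrable cone_measure (\<lambda>x. (u x)\<^sup>2) \<and>
     (\<exists>g. has_weak_deriv half_plane u (1, 0) g \<and> integrable cone_measure (\<lambda>x. (fst x * g x)\<^sup>2)) \<and>
     (\<exists>g. has_weak_deriv half_plane u (0, 1) g \<and> integrable cone_measure (\<lambda>x. (g x)\<^sup>2))}"

definition cone_gradient :: "(real \<times> real \<Rightarrow> real) \<Rightarrow> real \<times> real \<Rightarrow> real \<times> real" where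
  "cone_gradient u x =
     (fst x * weak_deriv half_plane u (1, 0) x, weak_deriv half_plane u (0, 1) x)"

definition exp_integrand :: "real \<Rightarrow> (real \<times> real \<Rightarrow> real) \<Rightarrow> real \<times> real \<Rightarrow> real" where
  "exp_integrand \<alpha> u x = exp (\<alpha> * (\<bar>u x\<bar>\<^sup>2 / (cone_L2_norm (cone_gradient u))\<^sup>2)) - 1"

definition exp_quotient :: "real \<Rightarrow> (real \<times> real \<Rightarrow> real) \<Rightarrow> real" where
  "exp_quotient \<alpha> u = 1 / (cone_L2_norm u)\<^sup>2 * (\<integral>x. exp_integrand \<alpha> u x \<partial>cone_measure)"

end

theory Submission
  imports Defs "HOL-Computational_Algebra.Polynomial" "HOL-Real_Asymp.Real_Asymp"
begin

text \<open>
  The map \<open>(x\<^sub>1, x\<^sub>2) \<mapsto> (ln x\<^sub>1, x\<^sub>2)\<close> carries the weighted half plane to the Euclidean plane with Lebesgue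
  measure and turns \<open>x\<^sub>1 \<partial>\<^sub>1\<close> into an ordinary partial derivative, so the claim is that the
  Trudinger-Moser functional of the plane, divided by \<open>|u|\<^sub>2\<^sup>2\<close>, is unbounded at the critical
  exponent \<open>4\<pi>\<close>. In place of Moser's truncated logarithms the proof uses a smooth version of them:
  with \<open>s\<close> the squared distance to the origin of the Euclidean plane, \<open>0 < a < 1\<close> and
  \<open>L = - ln a\<close>, take
    \<open>u\<^sub>a = W\<^sub>a(s) / sqrt (4 \<pi> D\<^sub>a)\<close>,  \<open>W\<^sub>a(s) = ln ((s + 1) / (s + a))\<close>.

  The squared distance distributes the measure of the plane as \<open>\<pi> ds\<close> on \<open>[0, \<infinity>)\<close>
  (\<open>distr_cone_radius_sq\<close>), so every integral needed is one-dimensional. The Dirichlet energy of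
  \<open>W\<^sub>a\<close> is \<open>4 \<pi> \<integral> s W\<^sub>a'(s)\<^sup>2 ds\<close>, which has an elementary primitive and equals \<open>4 \<pi> D\<^sub>a\<close> with
  \<open>D\<^sub>a = (1 + a) / (1 - a) L - 2\<close> (\<open>has_bochner_integral_log_energy\<close>). Three facts finish
  the argument:
  \<^item> \<open>L - 2 \<le> D\<^sub>a \<le> L\<close> (\<open>log_energy_bounds\<close>); the upper bound is what makes \<open>4\<pi>\<close> large enough;
  \<^item> \<open>\<integral> W\<^sub>a\<^sup>2\<close> is bounded uniformly in \<open>a\<close> (\<open>log_profile_L2\<close>), so \<open>|u\<^sub>a|\<^sub>2\<^sup>2 = O(1 / D\<^sub>a)\<close>;
  \<^item> on the disc \<open>s \<le> a\<close>, of area \<open>\<pi> a\<close>, \<open>4 \<pi> u\<^sub>a\<^sup>2 = W\<^sub>a\<^sup>2 / D\<^sub>a \<ge> (L - ln 2)\<^sup>2 / L \<ge> L - 2 ln 2\<close>, so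
    the exponential is at least \<open>1 / (4 a)\<close> there (\<open>exp_log_profile_ge\<close>) and its integral stays
    above a positive constant.

  Hence the quotient grows at least like a multiple of \<open>D\<^sub>a\<close>, which tends to infinity as
  \<open>a \<rightarrow> 0\<close>.

  The gradient in the theorem is an arbitrarily chosen weak derivative. Two general facts identify
  it: a continuous classical derivative is a weak derivative (\<open>has_weak_deriv_classical\<close>), and weak
  derivatives are unique almost everywhere (\<open>weak_deriv_unique\<close>). The second rests on
  smooth cut-offs of boxes, built from \<open>exp (- 1 / t)\<close>.
\<close>

section \<open>Smooth cut-offs of boxes\<close>

text \<open>Allowing a polynomial in \<open>1 / t\<close> in front of \<open>exp (- 1 / t)\<close> closes the family under
  differentiation; this is how smoothness at \<open>0\<close> is obtained.\<close>

definition flat_exp :: "real poly \<Rightarrow> real \<Rightarrow> real" where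
  "flat_exp q t = (if t > 0 then poly q (1 / t) * exp (- (1 / t)) else 0)"

lemma poly_times_exp_minus_tendsto_0: "((\<lambda>y::real. poly q y * exp (- y)) \<longlongrightarrow> 0) at_top"
proof -
  have "((\<lambda>y::real. \<Sum>i\<le>degree q. coeff q i * (y ^ i / exp y)) \<longlongrightarrow> (\<Sum>i\<le>degree q. coeff q i * 0)) at_top"
    by (intro tendsto_intros tendsto_power_div_exp_0)
  moreover have "(\<lambda>y::real. \<Sum>i\<le>degree q. coeff q i * (y ^ i / exp y)) = (\<lambda>y. poly q y * exp (- y))"
    by (simp add: fun_eq_iff poly_altdef sum_distrib_right exp_minus divide_inverse mult.assoc)
  ultimately show ?thesis by simp
qed

lemma flat_exp_tendsto_0: "(flat_exp q \<longlongrightarrow> 0) (at_right 0)"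
proof -
  have "(\<lambda>y. poly q y * exp (- y)) = (\<lambda>y. poly q (1 / inverse y) * exp (- (1 / inverse y)))"
    by (simp add: divide_inverse)
  then have "((\<lambda>t. poly q (1 / t) * exp (- (1 / t))) \<longlongrightarrow> 0) (at_right 0)"
    using poly_times_exp_minus_tendsto_0[of q] by (simp add: filterlim_at_right_to_top)
  then show ?thesis
    by (rule Lim_transform_eventually)
       (auto simp: flat_exp_def eventually_at_right_less[THEN eventually_mono])
qed

lemma DERIV_flat_exp:
  "(flat_exp q has_real_derivative flat_exp (monom 1 2 * (q - pderiv q)) t) (at t)"
proof -
  consider "t > 0" | "t < 0" | "t = 0" by linarith
  then show ?thesis
  proof cases
    case 1
    have "((\<lambda>t. poly q (1 / t) * exp (- (1 / t))) has_real_derivative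
            poly (monom 1 2 * (q - pderiv q)) (1 / t) * exp (- (1 / t))) (at t)"
      using 1 by (auto intro!: derivative_eq_intros simp: poly_monom field_simps power2_eq_square)
    moreover have "\<forall>\<^sub>F s in nhds t. flat_exp q s = poly q (1 / s) * exp (- (1 / s))"
      using eventually_nhds_in_open[of "{0<..}" t] 1 by (auto simp: flat_exp_def elim!: eventually_mono)
    ultimately show ?thesis
      using 1 by (subst DERIV_cong_ev[OF refl _ refl]) (auto simp: flat_exp_def)
  next
    case 2
    have "\<forall>\<^sub>F s in nhds t. flat_exp q s = 0"
      using eventually_nhds_in_open[of "{..<0}" t] 2 by (auto simp: flat_exp_def elim!: eventually_mono)
    then show ?thesis
      using 2 by (subst DERIV_cong_ev[OF refl _ refl]) (auto simp: flat_exp_def)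
  next
    case 3
    have "\<forall>\<^sub>F h::real in at_right 0. flat_exp (pCons 0 q) h = (flat_exp q (0 + h) - flat_exp q 0) / h"
      using eventually_at_right_less[of "0::real"] by (auto simp: flat_exp_def field_simps elim!: eventually_mono)
    from Lim_transform_eventually[OF flat_exp_tendsto_0 this]
    have "((\<lambda>h. (flat_exp q (0 + h) - flat_exp q 0) / h) \<longlongrightarrow> 0) (at_right 0)" .
    moreover have "\<forall>\<^sub>F h::real in at_left 0. 0 = (flat_exp q (0 + h) - flat_exp q 0) / h"
      unfolding eventually_at_filter by (intro always_eventually) (auto simp: flat_exp_def)
    from Lim_transform_eventually[OF tendsto_const this]
    have "((\<lambda>h. (flat_exp q (0 + h) - flat_exp q 0) / h) \<longlongrightarrow> 0) (at_left 0)" .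
    ultimately have "((\<lambda>h. (flat_exp q (0 + h) - flat_exp q 0) / h) \<longlongrightarrow> 0) (at 0)"
      by (intro filterlim_split_at_real)
    then show ?thesis
      unfolding 3 DERIV_def by (simp add: flat_exp_def)
  qed
qed

text \<open>A class of smooth functions containing the cut-offs below and visibly closed under directional
  derivatives, so that \<open>Ck\<close> follows by induction on the order alone.\<close>

inductive_set flat_exp_algebra :: "('a::euclidean_space \<Rightarrow> real) set" where
  const: "(\<lambda>x. c) \<in> flat_exp_algebra"
| ridge: "(\<lambda>x. flat_exp q (a \<bullet> x + b)) \<in> flat_exp_algebra"
| plus: "f \<in> flat_exp_algebra \<Longrightarrow> g \<in> flat_exp_algebra \<Longrightarrow> (\<lambda>x. f x + g x) \<in> flat_exp_algebra"
| times: "f \<in> flat_exp_algebra \<Longrightarrow> g \<in> flat_exp_algebra \<Longrightarrow> (\<lambda>x. f x * g x) \<in> flat_exp_algebra"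

lemma flat_exp_algebra_derivative:
  assumes "f \<in> flat_exp_algebra"
  shows "\<exists>f'. (\<forall>x. (f has_derivative f' x) (at x)) \<and> (\<forall>v. (\<lambda>x. f' x v) \<in> flat_exp_algebra)"
  using assms
proof induction
  case (const c)
  show ?case by (intro exI[of _ "\<lambda>x v. 0"]) (auto intro: flat_exp_algebra.const)
next
  case (ridge q a b)
  let ?q = "monom 1 2 * (q - pderiv q)"
  have "((\<lambda>x. flat_exp q (a \<bullet> x + b)) has_derivative (\<lambda>v. flat_exp ?q (a \<bullet> x + b) * (a \<bullet> v))) (at x)" for x :: 'a
  proof -
    have "((\<lambda>x. a \<bullet> x + b) has_derivative (\<lambda>v. a \<bullet> v)) (at x)"
      by (auto intro!: derivative_eq_intros)
    from has_derivative_compose[OF this DERIV_flat_exp[of q "a \<bullet> x + b", unfolded has_field_derivative_def]]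
    show ?thesis .
  qed
  then show ?case
    by (intro exI[of _ "\<lambda>x v. flat_exp ?q (a \<bullet> x + b) * (a \<bullet> v)"])
       (auto intro: flat_exp_algebra.intros)
next
  case (plus f g)
  then obtain f' g' where "\<forall>x. (f has_derivative f' x) (at x)" "\<forall>v. (\<lambda>x. f' x v) \<in> flat_exp_algebra"
    "\<forall>x. (g has_derivative g' x) (at x)" "\<forall>v. (\<lambda>x. g' x v) \<in> flat_exp_algebra" by blast
  then show ?case
    by (intro exI[of _ "\<lambda>x v. f' x v + g' x v"])
       (auto intro: flat_exp_algebra.plus has_derivative_add)
next
  case (times f g)
  then obtain f' g' where "\<forall>x. (f has_derivative f' x) (at x)" "\<forall>v. (\<lambda>x. f' x v) \<in> flat_exp_algebra"
    "\<forall>x. (g has_derivative g' x) (at x)" "\<forall>v. (\<lambda>x. g' x v) \<in> flat_exp_algebra" by blast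
  with times.hyps have
    "\<forall>x. ((\<lambda>x. f x * g x) has_derivative (\<lambda>v. f x * g' x v + f' x v * g x)) (at x)"
    "\<forall>v. (\<lambda>x. f x * g' x v + f' x v * g x) \<in> flat_exp_algebra"
    by (intro allI has_derivative_mult flat_exp_algebra.plus flat_exp_algebra.times; simp)+
  then show ?case by (intro exI[of _ "\<lambda>x v. f x * g' x v + f' x v * g x"] conjI)
qed

lemma flat_exp_algebra_Ck: "f \<in> flat_exp_algebra \<Longrightarrow> Ck n f"
proof (induction n arbitrary: f)
  case 0
  then show ?case
    using flat_exp_algebra_derivative[of f]
    by (auto intro!: continuous_at_imp_continuous_on dest!: spec intro: has_derivative_continuous)
next
  case (Suc n)
  obtain f' where f': "\<And>x. (f has_derivative f' x) (at x)" "\<And>v. (\<lambda>x. f' x v) \<in> flat_exp_algebra"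
    using flat_exp_algebra_derivative[OF Suc.prems] by blast
  have "frechet_derivative f (at x) = f' x" for x
    using frechet_derivative_at[OF f'(1)] by simp
  then show ?case using f' Suc.IH by (auto simp: differentiable_def)
qed

lemma flat_exp_algebra_prod:
  "finite I \<Longrightarrow> (\<And>i. i \<in> I \<Longrightarrow> f i \<in> flat_exp_algebra) \<Longrightarrow> (\<lambda>x. \<Prod>i\<in>I. f i x) \<in> flat_exp_algebra"
  by (induction I rule: finite_induct) (auto intro: flat_exp_algebra.intros)

text \<open>Scaling the argument of \<open>exp (- 1 / t)\<close> by \<open>n\<close> makes the factors tend to \<open>1\<close> wherever they
  are positive. The cut-offs therefore converge to the indicator of the open box while keeping a
  support inside the closed one.\<close>

definition box_cutoff :: "'a::euclidean_space \<Rightarrow> 'a \<Rightarrow> nat \<Rightarrow> 'a \<Rightarrow> real" where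
  "box_cutoff l r n x =
     (\<Prod>b\<in>Basis. flat_exp 1 (real n * ((x - l) \<bullet> b)) * flat_exp 1 (real n * ((r - x) \<bullet> b)))"

lemma flat_exp_1_bounds: "0 \<le> flat_exp 1 t" "flat_exp 1 t \<le> 1"
  by (auto simp: flat_exp_def)

lemma box_cutoff_bounds: "0 \<le> box_cutoff l r n x" "box_cutoff l r n x \<le> 1"
  unfolding box_cutoff_def
  by (auto intro!: prod_nonneg prod_le_1 mult_nonneg_nonneg mult_le_one flat_exp_1_bounds)

lemma box_cutoff_outside: "x \<notin> box l r \<Longrightarrow> box_cutoff l r n x = 0"
proof -
  assume "x \<notin> box l r"
  then obtain b where b: "b \<in> Basis" "(x - l) \<bullet> b \<le> 0 \<or> (r - x) \<bullet> b \<le> 0"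
    by (auto simp: mem_box inner_diff_left not_less)
  then have "flat_exp 1 (real n * ((x - l) \<bullet> b)) * flat_exp 1 (real n * ((r - x) \<bullet> b)) = 0"
    by (auto simp: flat_exp_def zero_less_mult_iff)
  then show ?thesis
    unfolding box_cutoff_def using b(1) by (intro prod_zero) auto
qed

lemma box_cutoff_tendsto: "(\<lambda>n. box_cutoff l r n x) \<longlonglongrightarrow> indicator (box l r) x"
proof (cases "x \<in> box l r")
  case True
  have lim: "(\<lambda>n. flat_exp 1 (real n * c)) \<longlonglongrightarrow> 1" if "c > 0" for c
  proof -
    have "(\<lambda>n. exp (- (1 / c * (1 / real n)))) \<longlonglongrightarrow> exp (- (1 / c * 0))"
      by (intro tendsto_intros lim_1_over_n)
    moreover have "\<forall>\<^sub>F n in sequentially. exp (- (1 / c * (1 / real n))) = flat_exp 1 (real n * c)"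
      using that by (intro eventually_mono[OF eventually_gt_at_top[of "0::nat"]]) (auto simp: flat_exp_def)
    ultimately show ?thesis by (auto intro: Lim_transform_eventually)
  qed
  have "(\<lambda>n. box_cutoff l r n x) \<longlonglongrightarrow> (\<Prod>b\<in>(Basis::'a set). 1 * 1)"
    unfolding box_cutoff_def using True
    by (intro tendsto_intros lim) (auto simp: mem_box inner_diff_left)
  then show ?thesis using True by simp
qed (simp add: box_cutoff_outside)

lemma box_cutoff_test_function:
  assumes "cbox l r \<subseteq> \<Omega>"
  shows "box_cutoff l r n \<in> test_functions \<Omega>"
proof -
  have eq: "box_cutoff l r n = (\<lambda>x. \<Prod>b\<in>Basis.
      flat_exp 1 ((real n *\<^sub>R b) \<bullet> x + - (real n * (l \<bullet> b))) *
      flat_exp 1 ((- real n *\<^sub>R b) \<bullet> x + real n * (r \<bullet> b)))"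
    by (auto simp: box_cutoff_def inner_diff_left inner_commute algebra_simps intro!: ext prod.cong)
  have "box_cutoff l r n \<in> flat_exp_algebra"
    unfolding eq by (intro flat_exp_algebra_prod flat_exp_algebra.intros) auto
  moreover have "{x. box_cutoff l r n x \<noteq> 0} \<subseteq> cbox l r"
    using box_cutoff_outside box_subset_cbox by blast
  then have "closure {x. box_cutoff l r n x \<noteq> 0} \<subseteq> cbox l r"
    by (intro closure_minimal) auto
  moreover from this have "compact (closure {x. box_cutoff l r n x \<noteq> 0})"
    using bounded_subset[OF bounded_cbox] by (auto simp: compact_eq_bounded_closed)
  ultimately show ?thesis
    using assms by (auto simp: test_functions_def flat_exp_algebra_Ck)
qed

section \<open>Uniqueness of weak derivatives\<close>

text \<open>The positive and the negative part of \<open>f\<close> are densities of two measures that agree on boxes, and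
  boxes form an intersection-stable generator of the Borel sets.\<close>

lemma AE_zero_if_box_integrals_zero:
  fixes f :: "'a::euclidean_space \<Rightarrow> real"
  assumes f: "integrable lborel f" and zero: "\<And>l r. (LINT x:box l r|lborel. f x) = 0"
  shows "AE x in lborel. f x = 0"
proof -
  note [measurable] = borel_measurable_integrable[OF f]
  let ?P = "density lborel (\<lambda>x. ennreal (f x))" and ?N = "density lborel (\<lambda>x. ennreal (- f x))"
  have eq: "emeasure ?P (box l r) = emeasure ?N (box l r)"
    and fin: "emeasure ?P (box l r) \<noteq> \<infinity>" for l r
  proof -
    have box: "integrable lborel (\<lambda>x. indicator (box l r) x * f x)"
      using integrable_mult_indicator[OF _ f, of "box l r"] by simp
    have pos: "emeasure ?P (box l r) = (\<integral>\<^sup>+x. ennreal (indicator (box l r) x * f x) \<partial>lborel)"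
      by (subst emeasure_density) (auto intro!: nn_integral_cong split: split_indicator)
    have neg: "emeasure ?N (box l r) = (\<integral>\<^sup>+x. ennreal (- (indicator (box l r) x * f x)) \<partial>lborel)"
      by (subst emeasure_density) (auto intro!: nn_integral_cong split: split_indicator)
    have "emeasure ?P (box l r) \<noteq> \<infinity>" "emeasure ?N (box l r) \<noteq> \<infinity>"
      using integrableD[OF box] unfolding pos neg by auto
    moreover have "enn2real (emeasure ?P (box l r)) - enn2real (emeasure ?N (box l r)) = 0"
      using zero[of l r] unfolding pos neg
      by (simp add: set_lebesgue_integral_def real_lebesgue_integral_def[OF box])
    ultimately show "emeasure ?P (box l r) = emeasure ?N (box l r)" "emeasure ?P (box l r) \<noteq> \<infinity>"
      by (metis ennreal_enn2real_if eq_iff_diff_eq_0 infinity_ennreal_def)+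
  qed
  have "?P = ?N"
  proof (rule measure_eqI_generator_eq)
    let ?E = "range (\<lambda>(a, b). box a b::'a set)"
    show "Int_stable ?E" by (auto simp: Int_stable_def box_Int_box)
    show "?E \<subseteq> Pow UNIV" "sets ?P = sigma_sets UNIV ?E" "sets ?N = sigma_sets UNIV ?E"
      by (simp_all add: borel_eq_box)
    let ?A = "\<lambda>n::nat. box (- (real n *\<^sub>R One)) (real n *\<^sub>R One) :: 'a set"
    show "range ?A \<subseteq> ?E" "(\<Union>i. ?A i) = UNIV" unfolding UN_box_eq_UNIV by auto
    show "emeasure ?P (?A i) \<noteq> \<infinity>" for i by (rule fin)
    show "emeasure ?P X = emeasure ?N X" if "X \<in> ?E" for X using that eq by auto
  qed
  then have "AE x in lborel. ennreal (f x) = ennreal (- f x)"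
    by (rule sigma_finite_measure.density_unique[OF sigma_finite_lborel, rotated 2]) simp_all
  then show ?thesis
  proof eventually_elim
    case (elim x)
    then show ?case by (cases "f x \<ge> 0") (auto simp: ennreal_neg)
  qed
qed

text \<open>Test both weak derivatives against the cut-offs of the box; by dominated convergence the
  cut-offs may be replaced by their limit, the indicator of the box.\<close>

lemma weak_deriv_box_integral_eq:
  assumes g: "has_weak_deriv \<Omega> u v g" and h: "has_weak_deriv \<Omega> u v h" and sub: "cbox l r \<subseteq> \<Omega>"
  shows "(LINT x:box l r|lborel. g x) = (LINT x:box l r|lborel. h x)"
proof -
  have lim: "(\<lambda>n. LINT x:\<Omega>|lborel. g x * box_cutoff l r n x) \<longlonglongrightarrow> (LINT x:box l r|lborel. g x)"
    if "locally_integrable_on \<Omega> g" for g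
  proof -
    have int: "integrable lborel (\<lambda>x. indicator (cbox l r) x * g x)"
      using that sub by (auto simp: locally_integrable_on_def set_integrable_def)
    have int': "integrable lborel (\<lambda>x. indicator (box l r) x * g x)"
      using set_integrable_subset[of lborel "cbox l r" g "box l r"] int
      by (simp add: set_integrable_def box_subset_cbox)
    have meas [measurable]: "box_cutoff l r n \<in> borel_measurable borel" for n
    proof -
      have "continuous_on UNIV (box_cutoff l r n)"
        using box_cutoff_test_function[OF sub, of n] by (auto simp: test_functions_def dest: spec[of _ 0])
      then show ?thesis by (rule borel_measurable_continuous_onI)
    qed
    have eq: "indicator \<Omega> x * (g x * box_cutoff l r n x) = box_cutoff l r n x * (indicator (box l r) x * g x)" for x n
      using sub box_subset_cbox[of l r] box_cutoff_outside[of x l r n]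
      by (cases "x \<in> box l r") (auto simp: indicator_def)
    have "(\<lambda>n. LINT x|lborel. box_cutoff l r n x * (indicator (box l r) x * g x)) \<longlonglongrightarrow>
        (LINT x|lborel. indicator (box l r) x * (indicator (box l r) x * g x))"
    proof (rule integral_dominated_convergence[where w = "\<lambda>x. \<bar>indicator (box l r) x * g x\<bar>"])
      note [measurable] = borel_measurable_integrable[OF int']
      show "(\<lambda>x. indicator (box l r) x * (indicator (box l r) x * g x)) \<in> borel_measurable lborel"
        "(\<lambda>x. box_cutoff l r n x * (indicator (box l r) x * g x)) \<in> borel_measurable lborel" for n
        by measurable
      show "AE x in lborel. (\<lambda>n. box_cutoff l r n x * (indicator (box l r) x * g x))
          \<longlonglongrightarrow> indicator (box l r) x * (indicator (box l r) x * g x)"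
        by (intro always_eventually allI tendsto_mult box_cutoff_tendsto tendsto_const)
      show "AE x in lborel. norm (box_cutoff l r n x * (indicator (box l r) x * g x))
          \<le> \<bar>indicator (box l r) x * g x\<bar>" for n
        using box_cutoff_bounds[of l r n] by (auto simp: abs_mult intro!: mult_left_le_one_le)
    qed (use int' in auto)
    moreover have "indicator (box l r) x * (indicator (box l r) x * g x) = indicator (box l r) x * g x" for x
      by (simp split: split_indicator)
    ultimately show ?thesis
      by (simp add: set_lebesgue_integral_def eq)
  qed
  have "(LINT x:\<Omega>|lborel. g x * box_cutoff l r n x) = (LINT x:\<Omega>|lborel. h x * box_cutoff l r n x)" for n
    using g h box_cutoff_test_function[OF sub, of n] unfolding has_weak_deriv_def by fastforce
  then show ?thesis
    using lim[of g] lim[of h] g h LIMSEQ_unique unfolding has_weak_deriv_def by auto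
qed

text \<open>Inside a closed box contained in \<open>\<Omega>\<close>, all integrals of \<open>g - h\<close> over smaller boxes vanish; countably many
  closed boxes cover \<open>\<Omega>\<close>.\<close>

lemma weak_deriv_unique:
  fixes \<Omega> :: "'a::euclidean_space set"
  assumes "open \<Omega>" and g: "has_weak_deriv \<Omega> u v g" and h: "has_weak_deriv \<Omega> u v h"
  shows "AE x in lborel. x \<in> \<Omega> \<longrightarrow> g x = h x"
proof -
  have cbox: "AE x in lborel. x \<in> cbox l r \<longrightarrow> g x = h x" if sub: "cbox l r \<subseteq> \<Omega>" for l r
  proof -
    let ?f = "\<lambda>x. indicator (box l r) x * (g x - h x)"
    have int: "set_integrable lborel (box a b) g" "set_integrable lborel (box a b) h"
      if "cbox a b \<subseteq> \<Omega>" for a b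
    proof -
      have *: "set_integrable lborel (cbox a b) g" "set_integrable lborel (cbox a b) h"
        using g h that by (auto simp: has_weak_deriv_def locally_integrable_on_def)
      show "set_integrable lborel (box a b) g" "set_integrable lborel (box a b) h"
        using *[THEN set_integrable_subset, of "box a b"] by (simp_all add: box_subset_cbox)
    qed
    have "AE x in lborel. ?f x = 0"
    proof (rule AE_zero_if_box_integrals_zero)
      show "integrable lborel ?f"
        using set_integral_diff(1)[OF int[OF sub]] by (simp add: set_integrable_def)
      fix l' r'
      obtain a b where ab: "box l r \<inter> box l' r' = box a b"
        unfolding box_Int_box by blast
      have "(LINT x:box l' r'|lborel. ?f x) = (LINT x:box a b|lborel. g x - h x)"
        unfolding set_lebesgue_integral_def ab[symmetric]
        by (intro Bochner_Integration.integral_cong) (auto split: split_indicator)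
      also have "\<dots> = 0"
      proof (cases "box a b = {}")
        case False
        then have "cbox a b = closure (box a b)" by simp
        also have "\<dots> \<subseteq> closure (box l r)" using ab by (intro closure_mono) auto
        also have "\<dots> \<subseteq> cbox l r" by (intro closure_minimal box_subset_cbox closed_cbox)
        finally have "cbox a b \<subseteq> \<Omega>" using sub by simp
        then show ?thesis
          using int weak_deriv_box_integral_eq[OF g h, of a b] by (simp add: set_integral_diff)
      qed (simp add: set_lebesgue_integral_def)
      finally show "(LINT x:box l' r'|lborel. ?f x) = 0" .
    qed
    \<comment> \<open>The interiors of the covering boxes need not cover, so the faces are discarded as null sets.\<close>
    moreover have "cbox l r - box l r \<in> null_sets lborel"
      by (simp add: emeasure_Diff emeasure_lborel_box_eq emeasure_lborel_cbox_eq null_setsI box_subset_cbox)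
    then have "AE x in lborel. x \<notin> cbox l r - box l r" by (rule AE_not_in)
    ultimately show ?thesis
      by eventually_elim (auto simp: indicator_def split: if_splits)
  qed
  obtain D where D: "countable D" "D \<subseteq> Pow \<Omega>" "\<And>X. X \<in> D \<Longrightarrow> \<exists>a b. X = cbox a b" "\<Union>D = \<Omega>"
    using open_countable_Union_open_cbox[OF \<open>open \<Omega>\<close>] by metis
  have "\<forall>X\<in>D. AE x in lborel. x \<in> X \<longrightarrow> g x = h x"
    using D(2,3) cbox by blast
  then have "AE x in lborel. \<forall>X\<in>D. x \<in> X \<longrightarrow> g x = h x"
    by (rule AE_ball_countable[OF D(1), THEN iffD2])
  then show ?thesis
    by eventually_elim (use D(4) in blast)
qed

text \<open>Local integrability speaks about compact sets only. A countable cover by closed boxes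
  turns it into measurability on \<open>\<Omega>\<close>, which is needed to replace one weak derivative by
  another under the integral.\<close>

lemma borel_measurable_locally_integrable:
  fixes \<Omega> :: "'a::euclidean_space set"
  assumes "open \<Omega>" and g: "locally_integrable_on \<Omega> g"
  shows "g \<in> borel_measurable (restrict_space lborel \<Omega>)"
proof -
  obtain D where D: "countable D" "D \<subseteq> Pow \<Omega>" "\<And>X. X \<in> D \<Longrightarrow> \<exists>a b. X = cbox a b" "\<Union>D = \<Omega>"
    using open_countable_Union_open_cbox[OF \<open>open \<Omega>\<close>] by metis
  show ?thesis
  proof (rule measurable_piecewise_restrict[OF D(1)])
    fix X assume "X \<in> D"
    then obtain a b where X: "X = cbox a b" "X \<subseteq> \<Omega>" using D by blast
    have "set_integrable lborel X g"
      using g X by (auto simp: locally_integrable_on_def)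
    then have "g \<in> borel_measurable (restrict_space lborel X)"
      using X by (subst borel_measurable_restrict_space_iff) (auto simp: set_integrable_def)
    moreover have "restrict_space (restrict_space lborel \<Omega>) X = restrict_space lborel X"
      using X by (subst restrict_restrict_space) (auto simp: Int_absorb1 \<open>open \<Omega>\<close>)
    ultimately show "g \<in> borel_measurable (restrict_space (restrict_space lborel \<Omega>) X)" by simp
    show "X \<inter> space (restrict_space lborel \<Omega>) \<in> sets (restrict_space lborel \<Omega>)"
      using X by (auto simp: sets_restrict_space space_restrict_space intro!: image_eqI[of _ _ X])
  qed (use D in \<open>auto simp: space_restrict_space\<close>)
qed

section \<open>Classical derivatives are weak derivatives\<close>

lemma compact_support_derivative_outside:
  assumes "closed K" "\<And>x. x \<notin> K \<Longrightarrow> h x = 0" "(h has_derivative D) (at x)" "x \<notin> K"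
  shows "D = (\<lambda>v. 0)"
proof -
  have "((\<lambda>x. 0) has_derivative D) (at x)"
    by (rule has_derivative_transform_within_open[OF assms(3), of "- K"]) (use assms in auto)
  then show ?thesis by (rule has_derivative_unique) (rule has_derivative_const)
qed

lemma integrable_continuous_compact_support:
  fixes f :: "'a::euclidean_space \<Rightarrow> real"
  assumes "compact K" "continuous_on K f" "\<And>x. x \<notin> K \<Longrightarrow> f x = 0"
  shows "integrable lborel f"
proof -
  have "(\<lambda>x. indicator K x *\<^sub>R f x) = f"
    using assms(3) by (fastforce simp: indicator_def)
  then show ?thesis using borel_integrable_compact[OF assms(1,2)] by simp
qed

text \<open>By translation invariance, every difference quotient of \<open>h\<close> in direction \<open>v\<close> has integral zero. The
  quotients converge to the derivative, are bounded by its supremum, and vanish outside a common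
  ball, so dominated convergence applies.\<close>

lemma integral_directional_derivative_eq_0:
  fixes h :: "'a::euclidean_space \<Rightarrow> real"
  assumes h: "\<And>x. (h has_derivative h' x) (at x)" and cont: "continuous_on UNIV (\<lambda>x. h' x v)"
    and K: "compact K" "\<And>x. x \<notin> K \<Longrightarrow> h x = 0"
  shows "(LINT x|lborel. h' x v) = 0"
proof -
  have h_cont: "continuous_on A h" for A
    using h by (meson continuous_at_imp_continuous_on has_derivative_continuous)
  have h_int: "integrable lborel h"
    using integrable_continuous_compact_support[OF K(1) h_cont K(2)] .
  have h'_0: "h' x v = 0" if "x \<notin> K" for x
    using compact_support_derivative_outside[OF compact_imp_closed[OF K(1)] K(2) h that] by simp
  have "compact ((\<lambda>x. h' x v) ` K)"
    using cont K(1) by (intro compact_continuous_image) (auto intro: continuous_on_subset)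
  then obtain M where M: "M > 0" "\<And>x. x \<in> K \<Longrightarrow> \<bar>h' x v\<bar> \<le> M"
    by (auto simp: bounded_pos dest!: compact_imp_bounded)
  have M: "M > 0" "\<bar>h' x v\<bar> \<le> M" for x
    using M h'_0[of x] by (cases "x \<in> K"; force)+
  obtain R where R: "\<And>x. x \<in> K \<Longrightarrow> norm x \<le> R"
    using compact_imp_bounded[OF K(1)] unfolding bounded_iff by blast
  have line: "((\<lambda>t. h (x + t *\<^sub>R v)) has_real_derivative h' (x + t *\<^sub>R v) v) (at t)" for x t
  proof -
    have "((\<lambda>t. x + t *\<^sub>R v) has_derivative (\<lambda>t. t *\<^sub>R v)) (at t)"
      by (auto intro!: derivative_eq_intros)
    from has_derivative_compose[OF this h]
    have "((\<lambda>t. h (x + t *\<^sub>R v)) has_derivative (\<lambda>s. h' (x + t *\<^sub>R v) (s *\<^sub>R v))) (at t)" .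
    moreover have "h' (x + t *\<^sub>R v) (s *\<^sub>R v) = h' (x + t *\<^sub>R v) v * s" for s
      using linear_scale[OF has_derivative_linear[OF h]] by (simp add: mult.commute)
    ultimately show ?thesis by (simp add: has_field_derivative_def)
  qed
  define d where "d = (\<lambda>(n::nat) x. (h (x + inverse (real (Suc n)) *\<^sub>R v) - h x) / inverse (real (Suc n)))"
  have shift: "integrable lborel (\<lambda>x. h (x + c))" "(LINT x|lborel. h (x + c)) = (LINT x|lborel. h x)" for c
  proof -
    have [measurable]: "h \<in> borel_measurable borel" using h_int by auto
    have "integrable (distr lborel borel ((+) c)) h" using h_int by (simp add: lborel_distr_plus)
    then show "integrable lborel (\<lambda>x. h (x + c))"
      by (subst (asm) integrable_distr_eq) (auto simp: add.commute)
    have "(LINT x|lborel. h x) = (LINT x|distr lborel borel ((+) c). h x)" by (simp add: lborel_distr_plus)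
    also have "\<dots> = (LINT x|lborel. h (x + c))"
      by (subst integral_distr) (auto simp: add.commute)
    finally show "(LINT x|lborel. h (x + c)) = (LINT x|lborel. h x)" by simp
  qed
  have d_int: "integrable lborel (d n)" "(LINT x|lborel. d n x) = 0" for n
    unfolding d_def using shift h_int by (auto simp del: of_nat_Suc)
  have "(\<lambda>n. LINT x|lborel. d n x) \<longlonglongrightarrow> (LINT x|lborel. h' x v)"
  proof (rule integral_dominated_convergence[where w = "\<lambda>x. M * indicator (cball 0 (R + norm v)) x"])
    show "(\<lambda>x. h' x v) \<in> borel_measurable lborel"
      using borel_measurable_continuous_onI[OF cont] by simp
    show "d n \<in> borel_measurable lborel" for n using d_int by auto
    show "integrable lborel (\<lambda>x. M * indicator (cball (0::'a) (R + norm v)) x)"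
      using emeasure_bounded_finite[OF bounded_cball]
      by (intro integrable_mult_right integrable_real_indicator) auto
    have "(\<lambda>n. d n x) \<longlonglongrightarrow> h' x v" for x
    proof -
      have "((\<lambda>t. (h (x + t *\<^sub>R v) - h x) / t) \<longlongrightarrow> h' x v) (at 0)"
        using line[of x 0] by (simp add: DERIV_def)
      moreover have "filterlim (\<lambda>n. inverse (real (Suc n))) (at 0) sequentially"
        using LIMSEQ_inverse_real_of_nat by (simp add: filterlim_at del: of_nat_Suc)
      ultimately show ?thesis unfolding d_def by (rule filterlim_compose)
    qed
    then show "AE x in lborel. (\<lambda>n. d n x) \<longlonglongrightarrow> h' x v" by simp
    \<comment> \<open>The ball is enlarged by the norm of \<open>v\<close> because the quotients look ahead by at most \<open>v\<close>.\<close>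
    have "\<bar>d n x\<bar> \<le> M * indicator (cball 0 (R + norm v)) x" for n x
    proof (cases "x \<in> cball 0 (R + norm v)")
      case True
      obtain z where "h (x + inverse (real (Suc n)) *\<^sub>R v) - h (x + 0 *\<^sub>R v) =
          (inverse (real (Suc n)) - 0) * h' (x + z *\<^sub>R v) v"
        using MVT2[of 0 "inverse (real (Suc n))", OF _ line] by (auto simp del: of_nat_Suc)
      then have "d n x = h' (x + z *\<^sub>R v) v" by (simp add: d_def del: of_nat_Suc)
      then show ?thesis using True M by simp
    next
      case False
      let ?c = "inverse (real (Suc n)) *\<^sub>R v"
      have "norm ?c \<le> norm v"
        by (simp add: mult_left_le_one_le inverse_le_1_iff)
      moreover have "norm x \<le> norm (x + ?c) + norm ?c"
        using norm_triangle_ineq4[of "x + ?c" ?c] by simp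
      ultimately have "norm (x + ?c) > R" "norm x > R"
        using False norm_ge_zero[of v] by (auto simp: not_le simp del: norm_scaleR of_nat_Suc norm_ge_zero)
      then have "x + ?c \<notin> K" "x \<notin> K"
        using R by fastforce+
      then show ?thesis using False K(2) by (simp add: d_def)
    qed
    then show "AE x in lborel. norm (d n x) \<le> M * indicator (cball 0 (R + norm v)) x" for n by simp
  qed
  then show ?thesis
    using LIMSEQ_unique[OF tendsto_const[of 0]] by (simp add: d_int)
qed

text \<open>Integration by parts: \<open>u \<phi>\<close> is differentiable on the whole space, because \<open>\<phi>\<close> vanishes near every
  point outside \<open>\<Omega>\<close>. It has compact support and a continuous derivative in direction \<open>v\<close>, so that
  derivative has integral zero.\<close>

lemma has_weak_deriv_classical:
  fixes \<Omega> :: "'a::euclidean_space set"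
  assumes "open \<Omega>" and u: "\<And>x. x \<in> \<Omega> \<Longrightarrow> (u has_derivative u' x) (at x)"
    and cont: "continuous_on \<Omega> (\<lambda>x. u' x v)"
  shows "has_weak_deriv \<Omega> u v (\<lambda>x. u' x v)"
proof -
  have u_cont: "continuous_on \<Omega> u"
    using u by (meson continuous_at_imp_continuous_on has_derivative_continuous)
  have loc: "locally_integrable_on \<Omega> f" if "continuous_on \<Omega> f" for f
    using that borel_integrable_compact unfolding locally_integrable_on_def set_integrable_def
    by (blast intro: continuous_on_subset)
  have "(LINT x:\<Omega>|lborel. u x * frechet_derivative \<phi> (at x) v) = - (LINT x:\<Omega>|lborel. u' x v * \<phi> x)"
    if \<phi>: "\<phi> \<in> test_functions \<Omega>" for \<phi>
  proof -
    define S where "S = closure {x. \<phi> x \<noteq> 0}"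
    have S: "compact S" "S \<subseteq> \<Omega>" "closed S" using \<phi> by (auto simp: test_functions_def S_def)
    have \<phi>_0: "\<phi> x = 0" if "x \<notin> S" for x
      using that closure_subset[of "{x. \<phi> x \<noteq> 0}"] by (auto simp: S_def)
    have "Ck 1 \<phi>" using \<phi> by (auto simp: test_functions_def)
    then have \<phi>': "(\<phi> has_derivative frechet_derivative \<phi> (at x)) (at x)"
      and \<phi>'_cont: "continuous_on UNIV (\<lambda>x. frechet_derivative \<phi> (at x) v)" for x
      by (auto simp: frechet_derivative_works)
    have \<phi>_cont: "continuous_on A \<phi>" for A
      using \<phi>' by (meson continuous_at_imp_continuous_on has_derivative_continuous)
    have \<phi>'_0: "frechet_derivative \<phi> (at x) = (\<lambda>v. 0)" if "x \<notin> S" for x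
      using compact_support_derivative_outside[OF S(3) \<phi>_0 \<phi>' that] .
    define h' where "h' = (\<lambda>x w. indicator \<Omega> x * (u x * frechet_derivative \<phi> (at x) w)
        + indicator \<Omega> x * (u' x w * \<phi> x))"
    have "((\<lambda>x. u x * \<phi> x) has_derivative h' x) (at x)" for x
    proof (cases "x \<in> \<Omega>")
      case True
      then show ?thesis using has_derivative_mult[OF u \<phi>', of x] by (simp add: h'_def)
    next
      case False
      have "((\<lambda>x. u x * \<phi> x) has_derivative (\<lambda>w. 0)) (at x)"
        by (rule has_derivative_transform_within_open[OF has_derivative_const, of "- S"])
           (use S False \<phi>_0 in auto)
      then show ?thesis using False by (simp add: h'_def)
    qed
    moreover have "continuous_on UNIV (\<lambda>x. h' x v)"
    proof -
      have "continuous_on \<Omega> (\<lambda>x. h' x v) \<longleftrightarrow>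
          continuous_on \<Omega> (\<lambda>x. u x * frechet_derivative \<phi> (at x) v + u' x v * \<phi> x)"
        by (intro continuous_on_cong) (auto simp: h'_def)
      also have "\<dots>"
        by (intro continuous_intros u_cont cont \<phi>_cont continuous_on_subset[OF \<phi>'_cont]) auto
      finally have "continuous_on \<Omega> (\<lambda>x. h' x v)" .
      moreover have "continuous_on (- S) (\<lambda>x. h' x v) \<longleftrightarrow> continuous_on (- S) (\<lambda>x. 0::real)"
        by (intro continuous_on_cong) (auto simp: h'_def \<phi>_0 \<phi>'_0)
      ultimately have "continuous_on (\<Omega> \<union> - S) (\<lambda>x. h' x v)"
        using S \<open>open \<Omega>\<close> by (intro continuous_on_open_Un) auto
      moreover have "\<Omega> \<union> - S = UNIV" using S by auto
      ultimately show ?thesis by simp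
    qed
    ultimately have "(LINT x|lborel. h' x v) = 0"
      by (rule integral_directional_derivative_eq_0[OF _ _ S(1)]) (simp add: \<phi>_0)
    moreover have int: "integrable lborel (\<lambda>x. indicator \<Omega> x * F x)"
      if "continuous_on \<Omega> F" "\<And>x. x \<notin> S \<Longrightarrow> F x = 0" for F :: "'a \<Rightarrow> real"
    proof (rule integrable_continuous_compact_support[OF S(1)])
      have "continuous_on S (\<lambda>x. indicator \<Omega> x * F x) \<longleftrightarrow> continuous_on S F"
        using S by (intro continuous_on_cong) auto
      then show "continuous_on S (\<lambda>x. indicator \<Omega> x * F x)"
        using continuous_on_subset[OF that(1) S(2)] by simp
    qed (use that in auto)
    have "integrable lborel (\<lambda>x. indicator \<Omega> x * (u x * frechet_derivative \<phi> (at x) v))"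
      by (intro int continuous_intros u_cont continuous_on_subset[OF \<phi>'_cont]) (auto simp: \<phi>'_0)
    moreover have "integrable lborel (\<lambda>x. indicator \<Omega> x * (u' x v * \<phi> x))"
      by (intro int continuous_intros cont \<phi>_cont) (auto simp: \<phi>_0)
    ultimately show ?thesis
      by (simp add: h'_def set_lebesgue_integral_def)
  qed
  then show ?thesis
    using loc[OF u_cont] loc[OF cont] by (auto simp: has_weak_deriv_def)
qed

section \<open>Logarithmic polar coordinates on the half plane\<close>

lemma open_half_plane: "open half_plane"
  unfolding half_plane_def by (intro open_Collect_less continuous_intros)

lemma half_plane_borel [measurable]: "half_plane \<in> sets borel"
  using open_half_plane by (rule borel_open)

lemma space_cone_measure: "space cone_measure = half_plane"
  by (simp add: cone_measure_def space_restrict_space)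

lemma borel_measurable_cone_measure_iff:
  "f \<in> borel_measurable cone_measure \<longleftrightarrow> f \<in> borel_measurable (restrict_space lborel half_plane)"
  by (simp add: cone_measure_def)

lemma measurable_cone_measureI: "f \<in> measurable borel N \<Longrightarrow> f \<in> measurable cone_measure N"
  by (simp add: cone_measure_def measurable_restrict_space1)

lemma borel_measurable_cone_density: "(\<lambda>x. ennreal (1 / fst x)) \<in> borel_measurable (restrict_space lborel half_plane)"
  by (intro measurable_restrict_space1) (simp add: borel_prod[symmetric])

lemma AE_cone_measure:
  assumes "AE x in lborel. x \<in> half_plane \<longrightarrow> P x"
  shows "AE x in cone_measure. P x"
proof -
  have "AE x in restrict_space lborel half_plane. P x"
    using assms by (simp add: AE_restrict_space_iff)
  then show ?thesis
    unfolding cone_measure_def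
    by (subst AE_density) (auto simp: borel_measurable_cone_density)
qed

lemma nn_integral_cone_measure:
  assumes [measurable]: "f \<in> borel_measurable borel"
  shows "(\<integral>\<^sup>+x. f x \<partial>cone_measure) = (\<integral>\<^sup>+x. ennreal (1 / fst x) * f x * indicator half_plane x \<partial>lborel)"
  unfolding cone_measure_def
  by (subst nn_integral_density) (auto simp: borel_measurable_cone_density measurable_restrict_space1 nn_integral_restrict_space)

text \<open>The one-dimensional change of variables \<open>x = exp t\<close>, on intervals.\<close>

lemma nn_integral_inverse_between_exp:
  assumes "a \<le> b"
  shows "(\<integral>\<^sup>+x. ennreal (1 / x) * indicator {exp a<..<exp b} x \<partial>lborel) = ennreal (b - a)"
proof -
  have "(\<integral>\<^sup>+x. ennreal (1 / x) * indicator {exp a<..<exp b} x \<partial>lborel) =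
      (\<integral>\<^sup>+x. ennreal (1 / x) * indicator {exp a..exp b} x \<partial>lborel)"
  proof (rule nn_integral_cong_AE)
    show "AE x in lborel. ennreal (1 / x) * indicator {exp a<..<exp b} x = ennreal (1 / x) * indicator {exp a..exp b} x"
      using AE_lborel_singleton[of "exp a"] AE_lborel_singleton[of "exp b"]
      by eventually_elim (auto simp: indicator_def)
  qed
  also have "\<dots> = ennreal (ln (exp b) - ln (exp a))"
  proof (rule nn_integral_FTC_Icc)
    fix x assume "x \<in> {exp a..exp b}"
    then have "x > 0" using order.strict_trans2[OF exp_gt_zero, of a x] by simp
    then show "(ln has_real_derivative 1 / x) (at x)"
      by (auto intro!: derivative_eq_intros)
    show "0 \<le> 1 / x" using \<open>x > 0\<close> by simp
  qed (use assms in auto)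
  finally show ?thesis by simp
qed

text \<open>Lebesgue measure is determined by the volumes of boxes, and the preimage of a box is again a
  box, whose weighted area factors.\<close>

lemma distr_cone_measure_ln: "distr cone_measure borel (\<lambda>x. (ln (fst x), snd x)) = lborel"
proof (rule lborel_eqI[symmetric])
  fix l u :: "real \<times> real"
  assume le: "\<And>b. b \<in> Basis \<Longrightarrow> l \<bullet> b \<le> u \<bullet> b"
  obtain l1 l2 u1 u2 where [simp]: "l = (l1, l2)" "u = (u1, u2)" by fastforce
  have le1: "l1 \<le> u1" "l2 \<le> u2"
    using le[of "(1, 0)"] le[of "(0, 1)"] by (auto simp: Basis_prod_def)
  have ln_iff: "x > 0 \<Longrightarrow> (l1 < ln x \<and> ln x < u1) \<longleftrightarrow> (exp l1 < x \<and> x < exp u1)" for x :: real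
    by (metis exp_less_cancel_iff exp_ln)
  have [measurable]: "(\<lambda>x. (ln (fst x), snd x)) \<in> measurable cone_measure (borel :: (real \<times> real) measure)"
    by (intro measurable_cone_measureI) (simp add: borel_prod[symmetric])
  have [measurable]: "(\<lambda>x::real\<times>real. (ln (fst x), snd x)) \<in> borel_measurable borel"
    by (simp add: borel_prod[symmetric])
  have "emeasure (distr cone_measure borel (\<lambda>x. (ln (fst x), snd x))) (box l u) =
      (\<integral>\<^sup>+x. indicator (box l u) x \<partial>distr cone_measure borel (\<lambda>x. (ln (fst x), snd x)))"
    by simp
  also have "\<dots> = (\<integral>\<^sup>+x. indicator (box l u) (ln (fst x), snd x) \<partial>cone_measure)"
    by (subst nn_integral_distr) auto
  also have "\<dots> = (\<integral>\<^sup>+x. ennreal (1 / fst x) * indicator (box l u) (ln (fst x), snd x) * indicator half_plane x \<partial>lborel)"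
    by (subst nn_integral_cone_measure) auto
  also have "\<dots> = (\<integral>\<^sup>+x. (ennreal (1 / fst x) * indicator {exp l1<..<exp u1} (fst x)) * indicator {l2<..<u2} (snd x)
      \<partial>(lborel \<Otimes>\<^sub>M lborel))"
    unfolding lborel_prod
  proof (rule nn_integral_cong)
    fix x :: "real \<times> real"
    have "(ln (fst x), snd x) \<in> box l u \<and> x \<in> half_plane \<longleftrightarrow>
        fst x \<in> {exp l1<..<exp u1} \<and> snd x \<in> {l2<..<u2}"
      using ln_iff[of "fst x"] order.strict_trans[OF exp_gt_zero, of l1 "fst x"]
      by (auto simp: half_plane_def mem_box Basis_prod_def)
    then show "ennreal (1 / fst x) * indicator (box l u) (ln (fst x), snd x) * indicator half_plane x =
        ennreal (1 / fst x) * indicator {exp l1<..<exp u1} (fst x) * indicator {l2<..<u2} (snd x)"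
      unfolding indicator_def by auto
  qed
  also have "\<dots> = (\<integral>\<^sup>+x. \<integral>\<^sup>+y. (ennreal (1 / x) * indicator {exp l1<..<exp u1} x) * indicator {l2<..<u2} y \<partial>lborel \<partial>lborel)"
    by (subst lborel.nn_integral_fst[symmetric]) auto
  also have "\<dots> = (\<integral>\<^sup>+x. (ennreal (1 / x) * indicator {exp l1<..<exp u1} x) * ennreal (u2 - l2) \<partial>lborel)"
    using le1 by (simp add: nn_integral_cmult)
  also have "\<dots> = ennreal (u1 - l1) * ennreal (u2 - l2)"
    using le1 by (simp add: nn_integral_multc nn_integral_inverse_between_exp)
  also have "\<dots> = ennreal (\<Prod>b\<in>Basis. (u - l) \<bullet> b)"
  proof -
    have "(\<Prod>b\<in>Basis. (u - l) \<bullet> b) = (u1 - l1) * (u2 - l2)"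
      by (simp add: Basis_prod_def)
    then show ?thesis using le1 by (simp add: ennreal_mult)
  qed
  finally show "emeasure (distr cone_measure borel (\<lambda>x. (ln (fst x), snd x))) (box l u) =
      ennreal (\<Prod>b\<in>Basis. (u - l) \<bullet> b)" .
qed simp

text \<open>Polar coordinates for radial integrands: the disc \<open>|x|\<^sup>2 \<le> s\<close> has area \<open>\<pi> s\<close>.\<close>

lemma distr_lborel_sum_squares:
  "distr lborel borel (\<lambda>x::real\<times>real. (fst x)\<^sup>2 + (snd x)\<^sup>2) =
     density lborel (\<lambda>s. ennreal pi * indicator {0..} s)" (is "?M = ?N")
proof (rule measure_eqI_generator_eq)
  let ?E = "range (\<lambda>s::real. {..s})"
  have [measurable]: "(\<lambda>x::real\<times>real. (fst x)\<^sup>2 + (snd x)\<^sup>2) \<in> borel_measurable borel"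
    by (simp add: borel_prod[symmetric])
  show "Int_stable ?E" by (auto simp: Int_stable_def)
  show "?E \<subseteq> Pow UNIV" "sets ?M = sigma_sets UNIV ?E" "sets ?N = sigma_sets UNIV ?E"
    by (simp_all add: borel_eq_atMost)
  have M: "emeasure ?M {..s} = ennreal (pi * s)" for s
  proof -
    have "emeasure ?M {..s} = emeasure lborel {x::real\<times>real. (fst x)\<^sup>2 + (snd x)\<^sup>2 \<le> s}"
      by (subst emeasure_distr) (auto simp: vimage_def)
    also have "\<dots> = ennreal (pi * s)"
    proof (cases "s \<ge> 0")
      case True
      have "{x::real\<times>real. (fst x)\<^sup>2 + (snd x)\<^sup>2 \<le> s} = cball 0 (sqrt s)"
        by (auto simp: norm_prod_def)
      then show ?thesis using True by (simp add: emeasure_cball unit_ball_vol_2)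
    next
      case False
      have "{x::real\<times>real. (fst x)\<^sup>2 + (snd x)\<^sup>2 \<le> s} = {}"
        using False by (auto dest: order_trans[OF sum_power2_ge_zero])
      then show ?thesis using False by (simp add: ennreal_neg mult_le_0_iff)
    qed
    finally show ?thesis .
  qed
  have N: "emeasure ?N {..s} = ennreal (pi * s)" for s
  proof -
    have "emeasure ?N {..s} = (\<integral>\<^sup>+x. ennreal pi * indicator {0..s} x \<partial>lborel)"
      by (subst emeasure_density) (auto intro!: nn_integral_cong split: split_indicator)
    also have "\<dots> = ennreal (pi * s)"
      by (cases "s \<ge> 0") (auto simp: nn_integral_cmult ennreal_mult ennreal_neg mult_le_0_iff)
    finally show ?thesis .
  qed
  show "emeasure ?M X = emeasure ?N X" if "X \<in> ?E" for X using that M N by auto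
  show "range (\<lambda>n::nat. {..real n}) \<subseteq> ?E" by auto
  show "(\<Union>n::nat. {..real n}) = UNIV" using real_arch_simple by auto
  show "emeasure ?M {..real n} \<noteq> \<infinity>" for n :: nat by (simp add: M)
qed

definition cone_radius_sq :: "real \<times> real \<Rightarrow> real" where
  "cone_radius_sq x = (ln (fst x))\<^sup>2 + (snd x)\<^sup>2"

lemma cone_radius_sq_nonneg: "cone_radius_sq x \<ge> 0"
  by (simp add: cone_radius_sq_def)

lemma borel_measurable_cone_radius_sq [measurable]: "cone_radius_sq \<in> borel_measurable borel"
  unfolding cone_radius_sq_def[abs_def] by (simp add: borel_prod[symmetric])

lemma distr_cone_radius_sq:
  "distr cone_measure borel cone_radius_sq = density lborel (\<lambda>s. ennreal pi * indicator {0..} s)"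
proof -
  let ?T = "\<lambda>x::real\<times>real. (ln (fst x), snd x)" and ?S = "\<lambda>x::real\<times>real. (fst x)\<^sup>2 + (snd x)\<^sup>2"
  have "?T \<in> measurable cone_measure borel"
    by (intro measurable_cone_measureI) (simp add: borel_prod[symmetric])
  moreover have "?S \<in> borel_measurable borel"
    by (simp add: borel_prod[symmetric])
  ultimately have "distr (distr cone_measure borel ?T) borel ?S = distr cone_measure borel (?S \<circ> ?T)"
    by (intro distr_distr)
  also have "?S \<circ> ?T = cone_radius_sq"
    by (auto simp: cone_radius_sq_def)
  finally show ?thesis
    by (simp add: distr_cone_measure_ln distr_lborel_sum_squares)
qed

text \<open>Radial integrals over the weighted half plane are reduced to finding a primitive.\<close>

lemma has_bochner_integral_cone_radial:
  fixes F G :: "real \<Rightarrow> real"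
  assumes [measurable]: "F \<in> borel_measurable borel"
    and G: "\<And>s. 0 \<le> s \<Longrightarrow> (G has_real_derivative F s) (at s)"
    and F: "\<And>s. 0 \<le> s \<Longrightarrow> 0 \<le> F s" and lim: "(G \<longlongrightarrow> T) at_top"
  shows "has_bochner_integral cone_measure (\<lambda>x. F (cone_radius_sq x)) (pi * (T - G 0))"
proof (rule has_bochner_integral_nn_integral)
  have [measurable]: "cone_radius_sq \<in> borel_measurable cone_measure"
    by (intro measurable_cone_measureI) simp
  show "(\<lambda>x. F (cone_radius_sq x)) \<in> borel_measurable cone_measure" by simp
  show "AE x in cone_measure. 0 \<le> F (cone_radius_sq x)"
    by (simp add: F cone_radius_sq_nonneg)
  have "G 0 \<le> G s" if "0 \<le> s" for s
    using that G F by (intro DERIV_nonneg_imp_nondecreasing[of 0 s G]) blast+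
  then have "G 0 \<le> T"
    by (intro tendsto_lowerbound[OF lim]) (auto simp: eventually_at_top_linorder)
  then show "0 \<le> pi * (T - G 0)" by simp
  have "(\<integral>\<^sup>+x. ennreal (F (cone_radius_sq x)) \<partial>cone_measure) =
      (\<integral>\<^sup>+s. ennreal (F s) \<partial>distr cone_measure borel cone_radius_sq)"
    by (subst nn_integral_distr) auto
  also have "\<dots> = (\<integral>\<^sup>+s. ennreal pi * (ennreal (F s) * indicator {0..} s) \<partial>lborel)"
    unfolding distr_cone_radius_sq
    by (subst nn_integral_density) (auto simp: mult_ac)
  also have "\<dots> = ennreal pi * ennreal (T - G 0)"
    using nn_integral_FTC_atLeast[OF assms(1) G F lim] by (simp add: nn_integral_cmult)
  also have "\<dots> = ennreal (pi * (T - G 0))"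
    using \<open>G 0 \<le> T\<close> by (simp add: ennreal_mult)
  finally show "(\<integral>\<^sup>+x. ennreal (F (cone_radius_sq x)) \<partial>cone_measure) = ennreal (pi * (T - G 0))" .
qed

lemma emeasure_cone_disc:
  assumes "a \<ge> 0"
  shows "emeasure cone_measure {x \<in> space cone_measure. cone_radius_sq x \<le> a} = ennreal (pi * a)"
proof -
  have [measurable]: "cone_radius_sq \<in> borel_measurable cone_measure"
    by (intro measurable_cone_measureI) simp
  have "emeasure cone_measure {x \<in> space cone_measure. cone_radius_sq x \<le> a} =
      emeasure (distr cone_measure borel cone_radius_sq) {..a}"
    by (subst emeasure_distr) (auto intro!: arg_cong[where f = "emeasure cone_measure"])
  also have "\<dots> = (\<integral>\<^sup>+x. ennreal pi * indicator {0..a} x \<partial>lborel)"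
    unfolding distr_cone_radius_sq
    by (subst emeasure_density) (auto intro!: nn_integral_cong split: split_indicator)
  also have "\<dots> = ennreal (pi * a)"
    using assms by (auto simp: nn_integral_cmult ennreal_mult)
  finally show ?thesis .
qed

section \<open>Calculus of the logarithmic profile\<close>

definition log_profile :: "real \<Rightarrow> real \<Rightarrow> real" where
  "log_profile a s = ln (s + 1) - ln (s + a)"

text \<open>The value of \<open>\<integral> s W\<^sub>a'(s)\<^sup>2 ds\<close> over \<open>[0, \<infinity>)\<close>.\<close>

definition log_energy :: "real \<Rightarrow> real" where
  "log_energy a = (1 + a) / (1 - a) * (- ln a) - 2"

lemma DERIV_log_profile:
  "0 < a \<Longrightarrow> 0 \<le> s \<Longrightarrow> (log_profile a has_real_derivative (1 / (s + 1) - 1 / (s + a))) (at s)"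
  unfolding log_profile_def[abs_def] by (auto intro!: derivative_eq_intros)

lemma log_profile_bounds:
  assumes "0 < a" "a < 1" "0 \<le> s"
  shows "0 \<le> log_profile a s" "log_profile a s \<le> - ln a"
proof -
  show "0 \<le> log_profile a s"
    using assms by (simp add: log_profile_def)
  have "a * (s + 1) \<le> s + a"
    using assms mult_right_mono[of a 1 s] by (simp add: algebra_simps)
  then have "ln (a * (s + 1)) \<le> ln (s + a)"
    using assms by (subst ln_le_cancel_iff) auto
  then show "log_profile a s \<le> - ln a"
    using assms by (simp add: log_profile_def ln_mult)
qed

text \<open>Since \<open>D\<^sub>a = L + 2 a L / (1 - a) - 2\<close>, the bounds amount to \<open>0 \<le> 2 a L / (1 - a) \<le> 2\<close>, of which
  the second is \<open>ln (1 / a) \<le> 1 / a - 1\<close>.\<close>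

lemma log_energy_bounds:
  assumes "0 < a" "a < 1"
  shows "- ln a - 2 \<le> log_energy a" "log_energy a \<le> - ln a"
proof -
  have "ln (1 / a) \<le> 1 / a - 1"
    using assms by (intro ln_le_minus_one) auto
  then have "a * (- ln a) \<le> 1 - a"
    using assms by (simp add: ln_div field_simps)
  then have "2 * a / (1 - a) * (- ln a) \<le> 2"
    using assms by (simp add: field_simps)
  moreover have "2 * a / (1 - a) * (- ln a) \<ge> 0"
    using assms by (intro mult_nonneg_nonneg) auto
  moreover have "(1 + a) / (1 - a) = 1 + 2 * a / (1 - a)"
    using assms by (simp add: field_simps)
  then have "log_energy a = - ln a + 2 * a / (1 - a) * (- ln a) - 2"
    unfolding log_energy_def by (simp only: distrib_right mult_1_left)
  ultimately show "- ln a - 2 \<le> log_energy a" "log_energy a \<le> - ln a"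
    by linarith+
qed

lemma DERIV_log_energy_primitive:
  fixes a s :: real
  assumes "0 < a" "a < 1" "0 \<le> s"
  shows "((\<lambda>s. (1 + a) / (1 - a) * (ln (s + a) - ln (s + 1)) + a / (s + a) + 1 / (s + 1))
    has_real_derivative s * (1 / (s + 1) - 1 / (s + a))\<^sup>2) (at s)"
proof -
  \<comment> \<open>In terms of \<open>p\<close> and \<open>q\<close> the claim is \<open>(1 + a) p q - a p\<^sup>2 - q\<^sup>2 = s (p - q)\<^sup>2\<close>; its left-hand
      side factors as \<open>(p - q) (q - a p)\<close>.\<close>
  define p q where pq_def: "p = 1 / (s + a)" "q = 1 / (s + 1)"
  have pq: "p - q = (1 - a) * p * q" "q - a * p = s * (p - q)"
    using assms by (auto simp: pq_def field_simps)
  have "((\<lambda>s. (1 + a) / (1 - a) * (ln (s + a) - ln (s + 1)) + a / (s + a) + 1 / (s + 1))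
    has_real_derivative ((1 + a) / (1 - a) * (p - q) - a * p\<^sup>2 - q\<^sup>2)) (at s)"
    using assms by (auto intro!: derivative_eq_intros simp: pq_def power2_eq_square)
  also have "(1 + a) / (1 - a) * (p - q) = (1 + a) * p * q"
    using assms by (simp add: pq(1))
  also have "(1 + a) * p * q - a * p\<^sup>2 - q\<^sup>2 = (p - q) * (q - a * p)"
    by (simp add: algebra_simps power2_eq_square)
  also have "\<dots> = s * (q - p)\<^sup>2"
    unfolding pq(2) by (simp add: algebra_simps power2_eq_square)
  finally show ?thesis by (simp add: pq_def)
qed

lemma has_bochner_integral_log_energy:
  assumes "0 < a" "a < 1"
  shows "has_bochner_integral cone_measure
    (\<lambda>x. cone_radius_sq x * (1 / (cone_radius_sq x + 1) - 1 / (cone_radius_sq x + a))\<^sup>2)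
    (pi * log_energy a)"
proof -
  let ?G = "\<lambda>s. (1 + a) / (1 - a) * (ln (s + a) - ln (s + 1)) + a / (s + a) + 1 / (s + 1)"
  have "(?G \<longlongrightarrow> 0) at_top"
    by real_asymp
  then have "has_bochner_integral cone_measure
    (\<lambda>x. cone_radius_sq x * (1 / (cone_radius_sq x + 1) - 1 / (cone_radius_sq x + a))\<^sup>2)
    (pi * (0 - ?G 0))"
    using DERIV_log_energy_primitive[OF assms]
    by (intro has_bochner_integral_cone_radial[where F = "\<lambda>s. s * (1 / (s + 1) - 1 / (s + a))\<^sup>2"]) auto
  moreover have "0 - ?G 0 = log_energy a"
    using assms by (simp add: log_energy_def)
  ultimately show ?thesis by metis
qed

text \<open>Apply \<open>ln y \<le> y - 1\<close> to \<open>y = (1 / r) powr (1 / 4)\<close>. The small exponent keeps the bound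
  integrable down to \<open>r = 0\<close>; the factor \<open>(1 - r)\<^sup>2\<close> retains the quadratic vanishing of the
  left-hand side at \<open>r = 1\<close>.\<close>

lemma ln_squared_le:
  fixes r :: real
  assumes "0 < r" "r \<le> 1"
  shows "(ln r)\<^sup>2 \<le> 16 * (1 - r)\<^sup>2 / sqrt r"
proof -
  define t where "t = sqrt (sqrt r)"
  have t: "0 < t" "t \<le> 1" and t2: "t\<^sup>2 = sqrt r" using assms by (auto simp: t_def)
  have r: "r = t ^ 4" using t2 assms power_mult[of t 2 2] by simp
  have "- ln r = 4 * ln (1 / t)"
    using t by (simp add: r ln_div ln_realpow)
  also have "\<dots> \<le> 4 * (1 / t - 1)"
    using t by (intro mult_left_mono ln_le_minus_one) auto
  also have "\<dots> = 4 * (1 - t) / t" using t by (simp add: field_simps)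
  also have "\<dots> \<le> 4 * (1 - r) / t"
    using t power_decreasing[of 1 4 t] by (simp add: r divide_right_mono)
  finally have "(- ln r)\<^sup>2 \<le> (4 * (1 - r) / t)\<^sup>2"
    using assms by (intro power_mono) auto
  also have "(4 * (1 - r) / t)\<^sup>2 = 16 * (1 - r)\<^sup>2 / sqrt r"
    unfolding power_divide power_mult_distrib t2 by simp
  finally show ?thesis by simp
qed

text \<open>With \<open>r = (s + a) / (s + 1)\<close>, the majorant \<open>16 (1 - r)\<^sup>2 / sqrt r\<close> of \<open>W\<^sub>a\<^sup>2 = (ln r)\<^sup>2\<close> is the
  derivative of \<open>32 (1 - a) sqrt r\<close> with respect to \<open>s\<close>, whose total increment is at most \<open>32\<close> for
  every \<open>a\<close>.\<close>

lemma log_profile_L2: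
  assumes a: "0 < a" "a < 1"
  shows "integrable cone_measure (\<lambda>x. (log_profile a (cone_radius_sq x))\<^sup>2)"
    and "(\<integral>x. (log_profile a (cone_radius_sq x))\<^sup>2 \<partial>cone_measure) \<le> 32 * pi"
proof -
  define r where "r = (\<lambda>s. (s + a) / (s + 1))"
  define F where "F = (\<lambda>s. 16 * (1 - r s)\<^sup>2 / sqrt (r s))"
  have r: "0 < r s" "r s \<le> 1" if "0 \<le> s" for s
    using that a by (auto simp: r_def)
  have [measurable]: "F \<in> borel_measurable borel" by (simp add: F_def r_def)
  have F_nonneg: "0 \<le> F s" if "0 \<le> s" for s using r[OF that] by (simp add: F_def)
  have "((\<lambda>s. 32 * (1 - a) * sqrt ((s + a) / (s + 1))) has_real_derivative F s) (at s)" if "0 \<le> s" for s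
  proof -
    have "(r has_real_derivative (1 - a) / (s + 1)\<^sup>2) (at s)"
      using that a unfolding r_def
      by (auto intro!: derivative_eq_intros simp: power2_eq_square divide_simps)
    from DERIV_cmult[OF DERIV_chain2[OF DERIV_real_sqrt[OF r(1)[OF that]] this], of "32 * (1 - a)"]
    have "((\<lambda>s. 32 * (1 - a) * sqrt (r s)) has_real_derivative
      32 * (1 - a) * (inverse (sqrt (r s)) / 2 * ((1 - a) / (s + 1)\<^sup>2))) (at s)" .
    moreover have *: "1 - r s = (1 - a) / (s + 1)" using that by (simp add: r_def field_simps)
    have "32 * c * (inverse S / 2 * (c / m\<^sup>2)) = 16 * (c / m)\<^sup>2 / S" for c m S :: real
      by (simp add: power2_eq_square divide_simps)
    then have "32 * (1 - a) * (inverse (sqrt (r s)) / 2 * ((1 - a) / (s + 1)\<^sup>2)) = F s"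
      unfolding F_def * .
    ultimately show ?thesis by (simp add: r_def)
  qed
  moreover have "((\<lambda>s. 32 * (1 - a) * sqrt ((s + a) / (s + 1))) \<longlongrightarrow> 32 * (1 - a)) at_top"
    by real_asymp
  ultimately have F: "has_bochner_integral cone_measure (\<lambda>x. F (cone_radius_sq x)) (pi * (32 * (1 - a) - 32 * (1 - a) * sqrt a))"
    using F_nonneg
      has_bochner_integral_cone_radial[of F "\<lambda>s. 32 * (1 - a) * sqrt ((s + a) / (s + 1))" "32 * (1 - a)"]
    by auto
  have le: "(log_profile a s)\<^sup>2 \<le> F s" if "0 \<le> s" for s
  proof -
    have "log_profile a s = - ln (r s)" using that a by (simp add: log_profile_def r_def ln_div)
    then show ?thesis using ln_squared_le[OF r[OF that]] by (simp add: F_def)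
  qed
  have [measurable]: "cone_radius_sq \<in> borel_measurable cone_measure"
    by (intro measurable_cone_measureI) simp
  note F_int = integrable.intros[OF F]
  show int: "integrable cone_measure (\<lambda>x. (log_profile a (cone_radius_sq x))\<^sup>2)"
  proof (rule Bochner_Integration.integrable_bound[OF F_int])
    show "(\<lambda>x. (log_profile a (cone_radius_sq x))\<^sup>2) \<in> borel_measurable cone_measure"
      by (simp add: log_profile_def)
    show "AE x in cone_measure. norm ((log_profile a (cone_radius_sq x))\<^sup>2) \<le> norm (F (cone_radius_sq x))"
      using le[OF cone_radius_sq_nonneg] F_nonneg[OF cone_radius_sq_nonneg] by simp
  qed
  have "(\<integral>x. (log_profile a (cone_radius_sq x))\<^sup>2 \<partial>cone_measure) \<le> (\<integral>x. F (cone_radius_sq x) \<partial>cone_measure)"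
    using le[OF cone_radius_sq_nonneg] by (intro integral_mono int F_int) auto
  also have "\<dots> = pi * (32 * ((1 - a) * (1 - sqrt a)))"
    using has_bochner_integral_integral_eq[OF F] by (simp add: algebra_simps)
  also have "\<dots> \<le> pi * (32 * 1)"
    using a by (intro mult_left_mono mult_le_one) auto
  finally show "(\<integral>x. (log_profile a (cone_radius_sq x))\<^sup>2 \<partial>cone_measure) \<le> 32 * pi"
    by simp
qed

text \<open>The heart of the matter: \<open>W\<^sub>a \<ge> L - ln 2\<close> for \<open>s \<le> a\<close>, and \<open>(L - ln 2)\<^sup>2 / D\<^sub>a \<ge> L - 2 ln 2\<close>
  because \<open>D\<^sub>a \<le> L\<close>. The condition \<open>a \<le> 1 / 16\<close> gives \<open>L \<ge> 4 ln 2 > 2\<close>, which makes \<open>D\<^sub>a\<close> positive.\<close>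

lemma exp_log_profile_ge:
  assumes a: "0 < a" "a \<le> 1 / 16" and s: "0 \<le> s" "s \<le> a"
  shows "1 / (4 * a) \<le> exp ((log_profile a s)\<^sup>2 / log_energy a)"
proof -
  define L where "L = - ln a"
  have "4 * ln 2 = ln (16 :: real)"
    using ln_realpow[of "2::real" 4] by simp
  also have "\<dots> \<le> L"
    using a ln_le_cancel_iff[of a "1 / 16"] by (simp add: L_def ln_div)
  finally have L: "4 * ln 2 \<le> L" .
  have ln2: "2 < 4 * ln (2::real)" using ln2_ge_two_thirds by simp
  have D: "0 < log_energy a" "log_energy a \<le> L"
    using log_energy_bounds[of a] a L ln2 by (auto simp: L_def)
  have "ln (s + a) \<le> ln (2 * a)" "0 \<le> ln (s + 1)" using a s by auto
  then have "L - ln 2 \<le> log_profile a s"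
    using a by (simp add: log_profile_def L_def ln_mult)
  then have "(L - ln 2)\<^sup>2 \<le> (log_profile a s)\<^sup>2"
    using L ln2 by (intro power_mono) linarith+
  moreover have "L * (L - 2 * ln 2) \<le> (L - ln 2)\<^sup>2"
    by (simp add: power2_eq_square algebra_simps)
  moreover have "log_energy a * (L - 2 * ln 2) \<le> L * (L - 2 * ln 2)"
    using D L by (intro mult_right_mono) auto
  ultimately have "L - 2 * ln 2 \<le> (log_profile a s)\<^sup>2 / log_energy a"
    using D by (simp add: field_simps)
  then have "exp (L - 2 * ln 2) \<le> exp ((log_profile a s)\<^sup>2 / log_energy a)" by simp
  moreover have "exp (L - 2 * ln 2) = 1 / (4 * a)"
    using a exp_double[of "ln (2::real)"] by (simp add: L_def exp_diff exp_minus field_simps)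
  ultimately show ?thesis by simp
qed

section \<open>The concentrating family\<close>

lemma has_weak_deriv_weak_deriv: "has_weak_deriv \<Omega> u v g \<Longrightarrow> has_weak_deriv \<Omega> u v (weak_deriv \<Omega> u v)"
  unfolding weak_deriv_def by (rule someI[of "has_weak_deriv \<Omega> u v"])

lemma borel_measurable_has_weak_deriv:
  "has_weak_deriv half_plane u v g \<Longrightarrow> g \<in> borel_measurable cone_measure"
  using borel_measurable_locally_integrable[OF open_half_plane]
  by (auto simp: has_weak_deriv_def borel_measurable_cone_measure_iff)

lemma borel_measurable_fst_cone_measure: "fst \<in> borel_measurable cone_measure"
  by (intro measurable_cone_measureI) (simp add: borel_prod[symmetric])

text \<open>The chosen weak derivatives may be replaced by any others, since they agree almost everywhere.\<close>

lemma cone_L2_norm_cone_gradient: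
  assumes g: "has_weak_deriv half_plane u (1, 0) g1" "has_weak_deriv half_plane u (0, 1) g2"
  shows "cone_L2_norm (cone_gradient u) = sqrt (\<integral>x. (fst x * g1 x)\<^sup>2 + (g2 x)\<^sup>2 \<partial>cone_measure)"
proof -
  let ?w1 = "weak_deriv half_plane u (1, 0)" and ?w2 = "weak_deriv half_plane u (0, 1)"
  note w = g[THEN has_weak_deriv_weak_deriv]
  note [measurable] = g[THEN borel_measurable_has_weak_deriv] w[THEN borel_measurable_has_weak_deriv]
    borel_measurable_fst_cone_measure
  have "AE x in cone_measure. ?w1 x = g1 x" "AE x in cone_measure. ?w2 x = g2 x"
    using AE_cone_measure[OF weak_deriv_unique[OF open_half_plane w(1) g(1)]]
      AE_cone_measure[OF weak_deriv_unique[OF open_half_plane w(2) g(2)]] by auto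
  then have "(\<integral>x. (fst x * ?w1 x)\<^sup>2 + (?w2 x)\<^sup>2 \<partial>cone_measure) = (\<integral>x. (fst x * g1 x)\<^sup>2 + (g2 x)\<^sup>2 \<partial>cone_measure)"
    by (intro integral_cong_AE) auto
  then show ?thesis
    by (simp add: cone_L2_norm_def cone_gradient_def norm_prod_def)
qed

text \<open>For \<open>y \<ge> 0\<close> one has \<open>exp y - 1 \<le> y exp y\<close>, so for bounded \<open>u\<close> the integrand is dominated by a multiple of \<open>u\<^sup>2\<close>.\<close>

lemma integrable_exp_square_minus_1:
  fixes u :: "'a \<Rightarrow> real"
  assumes [measurable]: "u \<in> borel_measurable M" and int: "integrable M (\<lambda>x. (u x)\<^sup>2)"
    and bound: "\<And>x. x \<in> space M \<Longrightarrow> (u x)\<^sup>2 \<le> B" and "0 \<le> \<alpha>"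
  shows "integrable M (\<lambda>x. exp (\<alpha> * (u x)\<^sup>2) - 1)"
proof (rule Bochner_Integration.integrable_bound)
  show "integrable M (\<lambda>x. (\<alpha> * exp (\<alpha> * B)) * (u x)\<^sup>2)" using int by simp
  have "\<bar>exp (\<alpha> * (u x)\<^sup>2) - 1\<bar> \<le> (\<alpha> * exp (\<alpha> * B)) * (u x)\<^sup>2" if "x \<in> space M" for x
  proof -
    define y where "y = \<alpha> * (u x)\<^sup>2"
    have y: "0 \<le> y" "y \<le> \<alpha> * B" using \<open>0 \<le> \<alpha>\<close> bound[OF that] by (auto simp: y_def mult_left_mono)
    have "exp y * (1 - y) \<le> exp y * exp (- y)"
      using exp_ge_add_one_self[of "- y"] by (intro mult_left_mono) auto
    then have "exp y - 1 \<le> y * exp y" by (simp add: exp_minus algebra_simps)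
    also have "\<dots> \<le> y * exp (\<alpha> * B)" using y by (intro mult_left_mono) auto
    finally show ?thesis using y by (simp add: y_def mult_ac)
  qed
  then show "AE x in M. norm (exp (\<alpha> * (u x)\<^sup>2) - 1) \<le> norm ((\<alpha> * exp (\<alpha> * B)) * (u x)\<^sup>2)"
    using \<open>0 \<le> \<alpha>\<close> by (intro AE_I2) (simp add: abs_mult)
qed simp

definition concentrating :: "real \<Rightarrow> real \<times> real \<Rightarrow> real" where
  "concentrating a x = log_profile a (cone_radius_sq x) / sqrt (4 * pi * log_energy a)"

lemma concentrating_has_weak_deriv:
  fixes a :: real
  assumes "0 < a"
  defines "w \<equiv> \<lambda>x. (1 / (cone_radius_sq x + 1) - 1 / (cone_radius_sq x + a)) / sqrt (4 * pi * log_energy a)"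
  shows "has_weak_deriv half_plane (concentrating a) (1, 0) (\<lambda>x. w x * (2 * ln (fst x) / fst x))"
    and "has_weak_deriv half_plane (concentrating a) (0, 1) (\<lambda>x. w x * (2 * snd x))"
proof -
  define D where "D = (\<lambda>x v. w x * (2 * ln (fst x) * (fst v / fst x) + 2 * snd x * snd v))"
  have D: "(concentrating a has_derivative D x) (at x)" if "x \<in> half_plane" for x
  proof -
    have "(cone_radius_sq has_derivative (\<lambda>v. 2 * ln (fst x) * (fst v / fst x) + 2 * snd x * snd v)) (at x)"
      using that unfolding cone_radius_sq_def[abs_def] half_plane_def
      by (auto intro!: derivative_eq_intros simp: field_simps)
    from has_derivative_compose[OF this
        DERIV_log_profile[OF assms(1) cone_radius_sq_nonneg, unfolded has_field_derivative_def]]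
    have "((\<lambda>x. log_profile a (cone_radius_sq x)) has_derivative
      (\<lambda>v. (1 / (cone_radius_sq x + 1) - 1 / (cone_radius_sq x + a)) *
        (2 * ln (fst x) * (fst v / fst x) + 2 * snd x * snd v))) (at x)" .
    from has_derivative_mult_left[OF this, of "1 / sqrt (4 * pi * log_energy a)"]
    show ?thesis
      by (simp add: concentrating_def[abs_def] D_def w_def mult_ac)
  qed
  have cont_r: "continuous_on half_plane cone_radius_sq"
    unfolding cone_radius_sq_def[abs_def] half_plane_def by (auto intro!: continuous_intros)
  have pos: "cone_radius_sq x + 1 \<noteq> 0" "cone_radius_sq x + a \<noteq> 0" for x
    using cone_radius_sq_nonneg[of x] assms by linarith+
  have cont: "continuous_on half_plane (\<lambda>x. D x v)" for v
    unfolding D_def w_def divide_inverse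
    by (intro continuous_intros cont_r) (auto simp: pos half_plane_def)
  show "has_weak_deriv half_plane (concentrating a) (1, 0) (\<lambda>x. w x * (2 * ln (fst x) / fst x))"
    "has_weak_deriv half_plane (concentrating a) (0, 1) (\<lambda>x. w x * (2 * snd x))"
    using has_weak_deriv_classical[OF open_half_plane D cont, of "(1, 0)"]
      has_weak_deriv_classical[OF open_half_plane D cont, of "(0, 1)"] by (simp_all add: D_def)
qed

lemma borel_measurable_concentrating: "concentrating a \<in> borel_measurable cone_measure"
  by (intro measurable_cone_measureI) (simp add: concentrating_def[abs_def] log_profile_def)

lemma concentrating_square_integral:
  assumes a: "0 < a" "a < 1" and D: "0 < log_energy a"
  shows "integrable cone_measure (\<lambda>x. (concentrating a x)\<^sup>2)"
    and "(cone_L2_norm (concentrating a))\<^sup>2 \<le> 8 / log_energy a"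
proof -
  have sq: "(\<lambda>x. (concentrating a x)\<^sup>2) = (\<lambda>x. (log_profile a (cone_radius_sq x))\<^sup>2 / (4 * pi * log_energy a))"
    using D by (simp add: concentrating_def power_divide)
  show "integrable cone_measure (\<lambda>x. (concentrating a x)\<^sup>2)"
    unfolding sq using log_profile_L2(1)[OF a] by simp
  have "(cone_L2_norm (concentrating a))\<^sup>2 = (\<integral>x. (concentrating a x)\<^sup>2 \<partial>cone_measure)"
    by (simp add: cone_L2_norm_def integral_nonneg_AE)
  also have "\<dots> = (\<integral>x. (log_profile a (cone_radius_sq x))\<^sup>2 \<partial>cone_measure) / (4 * pi * log_energy a)"
    unfolding sq by simp
  also have "\<dots> \<le> 32 * pi / (4 * pi * log_energy a)"
    using log_profile_L2(2)[OF a] D by (intro divide_right_mono) auto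
  finally show "(cone_L2_norm (concentrating a))\<^sup>2 \<le> 8 / log_energy a"
    using D by (simp add: field_simps)
qed

text \<open>In logarithmic coordinates \<open>|\<nabla>s|\<^sup>2 = 4 s\<close>, so the squared gradient of \<open>W\<^sub>a\<close> is \<open>4 s W\<^sub>a'(s)\<^sup>2\<close>; the
  normalising factor divides its integral \<open>4 \<pi> D\<^sub>a\<close> away.\<close>

lemma concentrating_in_cone_sobolev:
  assumes a: "0 < a" "a < 1" and D: "0 < log_energy a"
  shows "concentrating a \<in> cone_sobolev" and "cone_L2_norm (cone_gradient (concentrating a)) = 1"
proof -
  define w where "w = (\<lambda>x. (1 / (cone_radius_sq x + 1) - 1 / (cone_radius_sq x + a)) / sqrt (4 * pi * log_energy a))"
  let ?g1 = "\<lambda>x. w x * (2 * ln (fst x) / fst x)" and ?g2 = "\<lambda>x. w x * (2 * snd x)"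
  have g: "has_weak_deriv half_plane (concentrating a) (1, 0) ?g1" "has_weak_deriv half_plane (concentrating a) (0, 1) ?g2"
    unfolding w_def by (rule concentrating_has_weak_deriv[OF a(1)])+
  note [measurable] = g[THEN borel_measurable_has_weak_deriv] borel_measurable_fst_cone_measure
  have "has_bochner_integral cone_measure
      (\<lambda>x. 1 / (pi * log_energy a) * (cone_radius_sq x * (1 / (cone_radius_sq x + 1) - 1 / (cone_radius_sq x + a))\<^sup>2))
      (1 / (pi * log_energy a) * (pi * log_energy a))"
    by (intro has_bochner_integral_mult_right has_bochner_integral_log_energy a)
  also have "?this \<longleftrightarrow> has_bochner_integral cone_measure (\<lambda>x. (fst x * ?g1 x)\<^sup>2 + (?g2 x)\<^sup>2) 1"
  proof (rule has_bochner_integral_cong)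
    fix x assume "x \<in> space cone_measure"
    then have "fst x * ?g1 x = 2 * w x * ln (fst x)" by (auto simp: space_cone_measure half_plane_def)
    then have "(fst x * ?g1 x)\<^sup>2 + (?g2 x)\<^sup>2 = 4 * (w x)\<^sup>2 * cone_radius_sq x"
      by (simp only: cone_radius_sq_def) (simp add: power2_eq_square algebra_simps)
    also have "\<dots> = 1 / (pi * log_energy a) * (cone_radius_sq x * (1 / (cone_radius_sq x + 1) - 1 / (cone_radius_sq x + a))\<^sup>2)"
      using D by (simp add: w_def power_divide)
    finally show "1 / (pi * log_energy a) * (cone_radius_sq x * (1 / (cone_radius_sq x + 1) - 1 / (cone_radius_sq x + a))\<^sup>2) =
        (fst x * ?g1 x)\<^sup>2 + (?g2 x)\<^sup>2" by simp
  qed (use D in auto)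
  finally have energy: "has_bochner_integral cone_measure (\<lambda>x. (fst x * ?g1 x)\<^sup>2 + (?g2 x)\<^sup>2) 1" .
  show "cone_L2_norm (cone_gradient (concentrating a)) = 1"
    using cone_L2_norm_cone_gradient[OF g] has_bochner_integral_integral_eq[OF energy] by simp
  have "integrable cone_measure (\<lambda>x. (fst x * ?g1 x)\<^sup>2)" "integrable cone_measure (\<lambda>x. (?g2 x)\<^sup>2)"
    by (rule Bochner_Integration.integrable_bound[OF integrable.intros[OF energy]]; measurable; simp del: times_divide_eq_right)+
  then show "concentrating a \<in> cone_sobolev"
    using g borel_measurable_concentrating concentrating_square_integral(1)[OF a D]
    unfolding cone_sobolev_def by blast
qed

lemma exp_integrand_concentrating:
  assumes a: "0 < a" "a < 1" and D: "0 < log_energy a"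
  shows "exp_integrand \<alpha> (concentrating a) x = exp (\<alpha> * (concentrating a x)\<^sup>2) - 1"
  using concentrating_in_cone_sobolev(2)[OF assms] by (simp add: exp_integrand_def)

lemma integrable_exp_integrand_concentrating:
  assumes a: "0 < a" "a < 1" and D: "0 < log_energy a" and "0 \<le> \<alpha>"
  shows "integrable cone_measure (exp_integrand \<alpha> (concentrating a))"
proof -
  have "(concentrating a x)\<^sup>2 \<le> (- ln a)\<^sup>2 / (4 * pi * log_energy a)" for x
  proof -
    have "(log_profile a (cone_radius_sq x))\<^sup>2 \<le> (- ln a)\<^sup>2"
      using log_profile_bounds[OF a cone_radius_sq_nonneg] by (intro power_mono)
    then show ?thesis
      using D by (simp add: concentrating_def power_divide divide_right_mono)
  qed
  then have "integrable cone_measure (\<lambda>x. exp (\<alpha> * (concentrating a x)\<^sup>2) - 1)"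
    using borel_measurable_concentrating concentrating_square_integral(1)[OF a D] \<open>0 \<le> \<alpha>\<close>
    by (intro integrable_exp_square_minus_1) auto
  then show ?thesis
    by (simp add: exp_integrand_concentrating[OF a D, abs_def])
qed

text \<open>The disc of squared radius \<open>a\<close> alone contributes \<open>(1 / (4 a) - 1) \<pi> a = \<pi> / 4 - \<pi> a\<close>.\<close>

lemma exp_integral_concentrating_ge:
  assumes a: "0 < a" "a \<le> 1 / 16" and D: "0 < log_energy a"
  shows "pi / 8 \<le> (\<integral>x. exp_integrand (4 * pi) (concentrating a) x \<partial>cone_measure)"
proof -
  have a': "a < 1" using a by simp
  let ?d = "{x \<in> space cone_measure. cone_radius_sq x \<le> a}"
  have [measurable]: "cone_radius_sq \<in> borel_measurable cone_measure"
    by (intro measurable_cone_measureI) simp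
  have fin: "emeasure cone_measure ?d < \<infinity>" and m: "measure cone_measure ?d = pi * a"
    using emeasure_cone_disc[of a] a by (auto simp: measure_def)
  have "pi / 8 \<le> (1 / (4 * a) - 1) * (pi * a)"
    using a by (simp add: field_simps)
  also have "\<dots> = (\<integral>x. (1 / (4 * a) - 1) * indicator ?d x \<partial>cone_measure)"
    using fin m by simp
  also have "\<dots> \<le> (\<integral>x. exp_integrand (4 * pi) (concentrating a) x \<partial>cone_measure)"
  proof (rule integral_mono)
    show "integrable cone_measure (\<lambda>x. (1 / (4 * a) - 1) * indicator ?d x)"
      using fin by (intro integrable_mult_right integrable_real_indicator) auto
    show "integrable cone_measure (exp_integrand (4 * pi) (concentrating a))"
      using integrable_exp_integrand_concentrating[OF a(1) a' D] by simp
    fix x assume x: "x \<in> space cone_measure"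
    have "4 * pi * (concentrating a x)\<^sup>2 = (log_profile a (cone_radius_sq x))\<^sup>2 / log_energy a"
      using D by (simp add: concentrating_def power_divide)
    then show "(1 / (4 * a) - 1) * indicator ?d x \<le> exp_integrand (4 * pi) (concentrating a) x"
      using exp_log_profile_ge[OF a cone_radius_sq_nonneg[of x]] D x
      by (auto simp: exp_integrand_concentrating[OF a(1) a' D] indicator_def)
  qed
  finally show ?thesis .
qed

lemma exp_quotient_concentrating_ge:
  assumes a: "0 < a" "a \<le> 1 / 16" and D: "0 < log_energy a"
  shows "pi / 64 * log_energy a \<le> exp_quotient (4 * pi) (concentrating a)"
proof -
  have a': "a < 1" using a by simp
  let ?u = "concentrating a" and ?I = "\<integral>x. exp_integrand (4 * pi) (concentrating a) x \<partial>cone_measure"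
  note I = exp_integral_concentrating_ge[OF a D]
  note [measurable] = borel_measurable_concentrating
  \<comment> \<open>Otherwise \<open>u\<close> would vanish almost everywhere, and the exponential integral with it.\<close>
  have "cone_L2_norm ?u \<noteq> 0"
  proof
    assume "cone_L2_norm ?u = 0"
    then have "(\<integral>x. (?u x)\<^sup>2 \<partial>cone_measure) = 0" by (simp add: cone_L2_norm_def)
    then have "AE x in cone_measure. (?u x)\<^sup>2 = 0"
      using integral_nonneg_eq_0_iff_AE[OF concentrating_square_integral(1)[OF a(1) a' D]] by simp
    then have "?I = (\<integral>x. 0 \<partial>cone_measure)"
      using integrable_exp_integrand_concentrating[OF a(1) a' D, of "4 * pi"]
      by (intro integral_cong_AE) (auto simp: exp_integrand_concentrating[OF a(1) a' D])
    then show False using I pi_gt3 by simp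
  qed
  then have pos: "(cone_L2_norm ?u)\<^sup>2 > 0" by simp
  have "pi / 64 * log_energy a = (log_energy a / 8) * (pi / 8)" by simp
  also have "\<dots> \<le> 1 / (cone_L2_norm ?u)\<^sup>2 * ?I"
    using concentrating_square_integral(2)[OF a(1) a' D] pos D I
    by (intro mult_mono) (auto simp: field_simps)
  finally show ?thesis by (simp add: exp_quotient_def)
qed

theorem theorem3p3:
  fixes \<alpha> \<alpha>\<^sub>2 :: real
  assumes "\<alpha>\<^sub>2 = 4 * pi" and "\<alpha> \<ge> \<alpha>\<^sub>2"
  shows "\<exists>u :: nat \<Rightarrow> real \<times> real \<Rightarrow> real.
    (\<forall>k. u k \<in> cone_sobolev \<and> cone_L2_norm (cone_gradient (u k)) = 1) \<and>
    (\<forall>k. integrable cone_measure (exp_integrand \<alpha> (u k)) \<and>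
         integrable cone_measure (exp_integrand \<alpha>\<^sub>2 (u k))) \<and>
    (\<forall>k. exp_quotient \<alpha> (u k) \<ge> exp_quotient \<alpha>\<^sub>2 (u k)) \<and>
    filterlim (\<lambda>k. exp_quotient \<alpha>\<^sub>2 (u k)) at_top sequentially"
proof -
  \<comment> \<open>The shift by \<open>4\<close> ensures \<open>a k \<le> 1 / 16\<close> from \<open>k = 0\<close> on, using only \<open>exp 1 \<ge> 2\<close>.\<close>
  define a where "a = (\<lambda>k. exp (- (real k + 4)))"
  have a: "0 < a k" "a k \<le> 1 / 16" "a k < 1" for k
  proof -
    have "(2::real) \<le> exp 1" using exp_ge_add_one_self[of 1] by simp
    then have "2 ^ 4 \<le> exp (1::real) ^ 4" by (rule power_mono) simp
    also have "\<dots> = exp 4" using exp_of_nat_mult[of 4 "1::real"] by simp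
    also have "\<dots> \<le> exp (real k + 4)" by simp
    finally have "1 / exp (real k + 4) \<le> 1 / 16" by (intro divide_left_mono) auto
    moreover have "a k = 1 / exp (real k + 4)"
      by (simp only: a_def exp_minus divide_inverse mult_1)
    ultimately show "0 < a k" "a k \<le> 1 / 16" "a k < 1" by auto
  qed
  have D: "real k + 2 \<le> log_energy (a k)" "0 < log_energy (a k)" for k
    using log_energy_bounds(1)[OF a(1,3), of k] by (auto simp: a_def)
  have \<alpha>: "0 \<le> \<alpha>\<^sub>2" "0 \<le> \<alpha>" using assms by (auto intro: order_trans[of 0 "4 * pi"])
  have int: "integrable cone_measure (exp_integrand \<alpha> (concentrating (a k)))"
    "integrable cone_measure (exp_integrand \<alpha>\<^sub>2 (concentrating (a k)))" for k
    using integrable_exp_integrand_concentrating[OF a(1,3) D(2)] \<alpha> by auto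
  have mono: "exp_quotient \<alpha>\<^sub>2 (concentrating (a k)) \<le> exp_quotient \<alpha> (concentrating (a k))" for k
    unfolding exp_quotient_def using assms(2)
    by (intro mult_left_mono integral_mono int)
       (auto simp: exp_integrand_concentrating[OF a(1,3) D(2)] mult_right_mono)
  have "pi / 64 * real k \<le> exp_quotient \<alpha>\<^sub>2 (concentrating (a k))" for k
  proof -
    have "pi / 64 * real k \<le> pi / 64 * log_energy (a k)"
      using D(1)[of k] by (intro mult_left_mono) auto
    then show ?thesis
      using exp_quotient_concentrating_ge[OF a(1,2) D(2), of k] unfolding assms(1) by (rule order_trans)
  qed
  moreover have "filterlim (\<lambda>k. pi / 64 * real k) at_top sequentially"
    by real_asymp
  ultimately have "filterlim (\<lambda>k. exp_quotient \<alpha>\<^sub>2 (concentrating (a k))) at_top sequentially"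
    by (auto intro: filterlim_at_top_mono)
  then show ?thesis
    using int mono concentrating_in_cone_sobolev[OF a(1,3) D(2)]
    by (intro exI[of _ "\<lambda>k. concentrating (a k)"]) blast
qed

end
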